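(* For $x\ge 2$, $$M_{\omega}(x):=\sum_{1\le n\le x}\mu(n)\omega(n)=O\!\left(\frac{x}{\log x}\right),$$ with an absolute implied constant.
   Context: $\mu$ is the Möbius function and $\omega(n)$ is the number of distinct prime factors of $n$ (with $\omega(1)=0$). *)

theory Defs
  imports Complex_Main "HOL-Computational_Algebra.Squarefree"
begin

definition omega :: "nat \<Rightarrow> nat" where
  "omega n = card (prime_factors n)"

(* For n = 0, which is not squarefree, the value is 0. *)
definition moebius :: "nat \<Rightarrow> int" where
  "moebius n = (if squarefree n then (- 1) ^ card (prime_factors n) else 0)"

definition M_omega :: "real \<Rightarrow> real" where
  "M_omega x = (\<Sum>n | 1 \<le> n \<and> real n \<le> x. of_int (moebius n) * real (omega n))"

end

(*
  Write mu for the Moebius function and M for its summatory function. For a prime p, sorting the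
  multiples of p gives
    sum_{n <= N, p | n} mu(n) = - sum_{k >= 1} M(N / p^k),
  so the sum in question is minus the sum of M(N / q) over all prime powers q = p^k. If
  M(y) = O(y / log^2 y), then splitting the prime powers according to the size of N / q and counting
  them with Chebyshev's upper bound yields O(N / log N); any saving (log y)^(-A) with A > 1 would do.

  The bound on M needs the behaviour of 1/zeta on the line Re s = 1. The 3-4-1 inequality and an
  upper bound |zeta(s)| << |t|^eps to the left of this line give a zero-free region of width
  |t|^(-5 eps) in which |1/zeta| << |t|^(4 eps). Cauchy's estimates then bound the fourth derivative
  of 1/zeta, which is the Dirichlet series of mu(n) log^4 n, by |t|^(24 eps) uniformly in Re s > 1.
  Perron's formula with the absolutely convergent kernel 1/(s(s+1)) on Re s = 1 + 1/log N gives
    sum_{n <= N} mu(n) log^4 n (N - n) = O(N^2),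
  and differencing over an interval of length N / log^2 N gives sum_{n <= N} mu(n) log^4 n =
  O(N log^2 N). Partial summation removes the factor log^4 n.
*)

theory Submission
  imports "HOL-Complex_Analysis.Complex_Analysis" "HOL-Real_Asymp.Real_Asymp" Defs
begin

section \<open>The zeta function to the left of the line of absolute convergence\<close>

text \<open>The fourth derivative is a choice about logarithms. With weights log^k n, differencing
  over length h leaves N^2 / h + h log^k N, at best N log^(k/2) N, and partial summation then saves
  log^(k/2) N. Only k >= 3 saves more than one logarithm, and k = 4 makes the saving the integral
  power log^2 N. One logarithm would not do: the density of prime powers q carries a factor 1 / log
  q, and a saving of 1 / j in the j-th dyadic range of N / q, convolved with that density, leaves an
  extra factor log log N.

  The contour stays to the right of Re s = 1. On Re s = 1 + 1 / log N the factor N^s has size e N,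
  so the zero-free region serves only as room for Cauchy discs around points with Re s >= 1. This is
  why a region of width a small power of 1 / |t| suffices: four Cauchy estimates cost a power of
  |t|, and \<open>eps\<close> is small enough for the kernel to absorb it.\<close>

abbreviation mu :: "nat \<Rightarrow> int" where "mu \<equiv> Defs.moebius"

text \<open>
  Chosen such that \<open>(1 + \<bar>t\<bar>) powr (24 * eps)\<close> is a square root, which is integrable against the
  Perron kernel of order \<open>1 / t ^ 2\<close>.
\<close>
definition eps :: real where "eps = 1 / 48"

text \<open>
  The summands of the series for \<open>(s - 1) * zeta s - 1\<close>: the difference of the powers telescopes
  for \<open>Re s > 1\<close>, and each summand is entire and decays like \<open>n powr (- Re s - 1)\<close>.
\<close>
definition zeta_term :: "complex \<Rightarrow> nat \<Rightarrow> complex" where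
  "zeta_term s n = (s - 1) * of_nat (Suc n) powr (- s)
      + (of_nat (Suc (Suc n)) powr (1 - s) - of_nat (Suc n) powr (1 - s))"

lemma norm_of_nat_powr: "n > 0 \<Longrightarrow> norm (of_nat n powr s :: complex) = real n powr Re s"
  by (subst norm_powr_real_powr) auto

lemma powr_diff_bound:
  fixes s :: complex and x y :: real
  assumes "1 \<le> x" "x \<le> y" "y \<le> x + 1" "Re s \<ge> 0"
  shows "norm (of_real y powr (- s) - of_real x powr (- s)) \<le> norm s * x powr (- Re s - 1)"
proof -
  have d: "((\<lambda>t. of_real t powr (- s)) has_vector_derivative (- s * of_real t powr (- s - 1))) (at t within {x..y})"
    if "t \<in> {x..y}" for t
  proof -
    have "((\<lambda>z. z powr (-s)) has_field_derivative (- s * of_real t powr (- s - 1))) (at (of_real t))"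
      by (rule has_field_derivative_powr) (use that assms in auto)
    from has_vector_derivative_real_field[OF this] show ?thesis
      by (auto intro: has_vector_derivative_at_within)
  qed
  have b: "norm (- s * of_real t powr (- s - 1)) \<le> norm s * x powr (- Re s - 1)" if "t \<in> {x..y}" for t
  proof -
    have "norm (of_real t powr (- s - 1)) = t powr (- Re s - 1)"
      using that assms by (subst norm_powr_real_powr) auto
    also have "\<dots> \<le> x powr (- Re s - 1)"
      using that assms by (intro powr_mono2') auto
    finally show ?thesis by (simp add: norm_mult mult_left_mono)
  qed
  have "norm (of_real y powr (- s) - of_real x powr (- s)) \<le> (norm s * x powr (- Re s - 1)) * norm (y - x)"
    by (rule differentiable_bound[of "{x..y}" _ "\<lambda>t h. h *\<^sub>R (- s * of_real t powr (- s - 1))"])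
       (use d b assms in \<open>auto simp: has_vector_derivative_def simp del: mult_minus_left
          intro!: onorm_bound mult_left_mono simp: mult.commute[of "norm s * _"]\<close>)
  also have "\<dots> \<le> norm s * x powr (- Re s - 1) * 1"
    using assms by (intro mult_left_mono) auto
  finally show ?thesis by simp
qed

text \<open>
  The summand is at most \<open>norm (s - 1) * n powr (- Re s) * min 2 (norm s / n)\<close>; interpolating the
  minimum trades a power \<open>norm s powr eps\<close> for convergence to the left of 1.
\<close>
lemma zeta_term_bound:
  assumes "Re s \<ge> 0"
  shows "norm (zeta_term s n) \<le> 2 * norm (s - 1) * norm s powr eps * real (Suc n) powr (- Re s - eps)"
proof -
  define x where "x = real (Suc n)"
  have x: "x \<ge> 1" by (simp add: x_def)
  define B where "B = x powr (- Re s) * min 2 (norm s / x)"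
  have pd: "norm (of_real t powr (- s) - of_real x powr (- s)) \<le> B" if "t \<in> {x..x+1}" for t
  proof -
    have "norm (of_real t powr (- s) - of_real x powr (- s)) \<le> norm s * x powr (- Re s - 1)"
      by (rule powr_diff_bound) (use that x assms in auto)
    also have "\<dots> = x powr (- Re s) * (norm s / x)"
      using x by (simp add: powr_diff)
    finally have 1: "norm (of_real t powr (- s) - of_real x powr (- s)) \<le> x powr (- Re s) * (norm s / x)" .
    have "norm (of_real t powr (- s) - of_real x powr (- s)) \<le> t powr (- Re s) + x powr (- Re s)"
      using norm_triangle_ineq4[of "of_real t powr (- s)" "of_real x powr (- s)"] that x
      by (simp add: norm_powr_real_powr)
    also have "t powr (- Re s) \<le> x powr (- Re s)"
      using that x assms by (intro powr_mono2') auto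
    finally have 2: "norm (of_real t powr (- s) - of_real x powr (- s)) \<le> x powr (- Re s) * 2" by simp
    show ?thesis using 1 2 unfolding B_def min_def by auto
  qed
  have d: "((\<lambda>t. of_real t powr (1 - s)) has_vector_derivative ((1 - s) * of_real t powr (- s))) (at t within {x..x+1})"
    if "t \<in> {x..x+1}" for t
  proof -
    have "((\<lambda>z. z powr (1 - s)) has_field_derivative ((1 - s) * of_real t powr (1 - s - 1))) (at (of_real t))"
      by (rule has_field_derivative_powr) (use that x in auto)
    from has_vector_derivative_real_field[OF this] show ?thesis
      by (auto intro: has_vector_derivative_at_within)
  qed
  \<comment> \<open>\<open>zeta_term s n\<close> is the first-order Taylor remainder of t^(1-s) on
    [x, x+1], so it is controlled by the variation of the derivative (1-s) t^(-s), which
    \<open>pd\<close> bounds.\<close>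
  have "norm (of_real (x + 1) powr (1 - s) - of_real x powr (1 - s) - (x + 1 - x) *\<^sub>R ((1 - s) * of_real x powr (- s)))
          \<le> norm (x + 1 - x) * (norm (1 - s) * B)"
  proof (rule vector_differentiable_bound_linearization[of "{x..x+1}"])
    show "norm ((1 - s) * of_real t powr (- s) - (1 - s) * of_real x powr (- s)) \<le> norm (1 - s) * B"
      if "t \<in> {x..x+1}" for t
    proof -
      have "norm ((1 - s) * of_real t powr (- s) - (1 - s) * of_real x powr (- s))
          = norm (1 - s) * norm (of_real t powr (- s) - of_real x powr (- s))"
        by (simp add: norm_mult[symmetric] algebra_simps)
      also have "\<dots> \<le> norm (1 - s) * B" by (intro mult_left_mono pd that) auto
      finally show ?thesis .
    qed
  qed (use d in \<open>auto simp: closed_segment_eq_real_ivl\<close>)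
  also have "of_real (x + 1) powr (1 - s) - of_real x powr (1 - s) - (x + 1 - x) *\<^sub>R ((1 - s) * of_real x powr (- s)) = zeta_term s n"
    by (simp add: zeta_term_def x_def algebra_simps)
  finally have *: "norm (zeta_term s n) \<le> norm (s - 1) * B"
    by (simp add: norm_minus_commute)
  have "min 2 (norm s / x) \<le> 2 * (norm s / x) powr eps"
  proof (cases "norm s / x \<ge> 1")
    case True
    then have "(norm s / x) powr eps \<ge> 1" by (intro ge_one_powr_ge_zero) (auto simp: eps_def)
    then show ?thesis by (simp add: min_def)
  next
    case False
    have "norm s / x \<le> (norm s / x) powr eps"
    proof (cases "s = 0")
      case f: False
      have "(norm s / x) powr 1 \<le> (norm s / x) powr eps"
        by (rule powr_mono') (use f False x in \<open>auto simp: eps_def field_simps\<close>)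
      then show ?thesis using f x by simp
    qed auto
    moreover have "(norm s / x) powr eps \<ge> 0" by simp
    ultimately show ?thesis by linarith
  qed
  also have "(norm s / x) powr eps = norm s powr eps * x powr (- eps)"
    using x by (simp add: powr_divide powr_minus field_simps)
  finally have "B \<le> x powr (- Re s) * (2 * (norm s powr eps * x powr (- eps)))"
    unfolding B_def by (intro mult_left_mono) auto
  also have "\<dots> = 2 * norm s powr eps * x powr (- Re s - eps)"
    by (simp add: powr_diff powr_minus divide_inverse)
  finally have "norm (s - 1) * B \<le> norm (s - 1) * (2 * norm s powr eps * x powr (- Re s - eps))"
    by (rule mult_left_mono) auto
  with * show ?thesis by (simp add: x_def mult_ac)
qed

definition zeta_num :: "complex \<Rightarrow> complex" where
  "zeta_num s = 1 + (\<Sum>n. zeta_term s n)"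

text \<open>The bound on \<open>zeta_term\<close> has exponent - Re s - eps. Stopping at 1 - eps / 2
  keeps it below - 1 - eps / 2, so that one convergent series dominates on the whole
  half-plane.\<close>

definition zeta_halfplane :: "complex set" where "zeta_halfplane = {s. Re s > 1 - eps / 2}"

lemma open_zeta_halfplane [simp]: "open zeta_halfplane"
  by (simp add: zeta_halfplane_def open_halfspace_Re_gt)

definition zeta_term_const :: real where "zeta_term_const = (\<Sum>n. real (Suc n) powr (- 1 - eps / 2))"

lemma summable_zeta_term_const: "summable (\<lambda>n. real (Suc n) powr (- 1 - eps / 2))"
  by (subst summable_Suc_iff[where f = "\<lambda>n. real n powr (- 1 - eps / 2)"], subst summable_real_powr_iff) (simp add: eps_def)

lemma zeta_term_bound_halfplane:
  assumes "s \<in> zeta_halfplane"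
  shows "norm (zeta_term s n) \<le> 2 * norm (s - 1) * norm s powr eps * real (Suc n) powr (- 1 - eps / 2)"
proof -
  have "norm (zeta_term s n) \<le> 2 * norm (s - 1) * norm s powr eps * real (Suc n) powr (- Re s - eps)"
    by (rule zeta_term_bound) (use assms in \<open>auto simp: zeta_halfplane_def eps_def\<close>)
  also have "\<dots> \<le> 2 * norm (s - 1) * norm s powr eps * real (Suc n) powr (- 1 - eps / 2)"
    by (intro mult_left_mono powr_mono) (use assms in \<open>auto simp: zeta_halfplane_def\<close>)
  finally show ?thesis .
qed

lemma summable_zeta_term:
  assumes "s \<in> zeta_halfplane" shows "summable (zeta_term s)"
  by (rule summable_comparison_test'[OF _ zeta_term_bound_halfplane[OF assms]]) (intro summable_mult summable_zeta_term_const)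

lemma zeta_term_const_nonneg: "zeta_term_const \<ge> 0"
  unfolding zeta_term_const_def by (intro suminf_nonneg summable_zeta_term_const) auto

lemma zeta_num_bound:
  assumes "s \<in> zeta_halfplane"
  shows "norm (zeta_num s - 1) \<le> 2 * zeta_term_const * norm (s - 1) * norm s powr eps"
proof -
  have "norm (\<Sum>n. zeta_term s n) \<le> (\<Sum>n. 2 * norm (s - 1) * norm s powr eps * real (Suc n) powr (- 1 - eps / 2))"
    by (rule norm_suminf_le[OF zeta_term_bound_halfplane[OF assms]]) (intro summable_mult summable_zeta_term_const)
  also have "\<dots> = 2 * norm (s - 1) * norm s powr eps * zeta_term_const"
    unfolding zeta_term_const_def by (rule suminf_mult[OF summable_zeta_term_const])
  finally show ?thesis by (simp add: zeta_num_def mult_ac)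
qed

lemma zeta_num_1 [simp]: "zeta_num 1 = 1"
  using zeta_num_bound[of 1] by (simp add: zeta_halfplane_def eps_def)

text \<open>Weierstrass test: on a unit ball around \<open>x\<close> the factors depending on the
  point are bounded by a constant \<open>A\<close>, and one summable sequence dominates all summands
  there.\<close>

lemma holomorphic_zeta_num: "zeta_num holomorphic_on zeta_halfplane"
proof -
  define dz where "dz = (\<lambda>n s. deriv (\<lambda>s. zeta_term s n) s)"
  have hol: "(\<lambda>s. zeta_term s n) holomorphic_on UNIV" for n
    unfolding zeta_term_def by (intro holomorphic_intros)
  have "\<exists>g g'. \<forall>x \<in> zeta_halfplane. ((\<lambda>n. zeta_term x n) sums g x) \<and> ((\<lambda>n. dz n x) sums g' x) \<and> (g has_field_derivative g' x) (at x)"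
  proof (rule series_and_derivative_comparison_local)
    show "((\<lambda>s. zeta_term s n) has_field_derivative dz n x) (at x)" for n x
      unfolding dz_def by (rule holomorphic_derivI[OF hol]) auto
    fix x assume x: "x \<in> zeta_halfplane"
    define A where "A = 2 * (norm x + 2) * (norm x + 1) powr eps"
    have "norm (zeta_term y n) \<le> A * real (Suc n) powr (- 1 - eps / 2)" if "y \<in> ball x 1 \<inter> zeta_halfplane" for y n
    proof -
      have *: "norm y \<le> norm x + 1"
        using that norm_triangle_ineq2[of y x] by (auto simp: dist_norm norm_minus_commute)
      have **: "norm (y - 1) \<le> norm x + 2"
        using * norm_triangle_ineq4[of y 1] by auto
      have "norm (zeta_term y n) \<le> 2 * norm (y - 1) * norm y powr eps * real (Suc n) powr (- 1 - eps / 2)"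
        by (rule zeta_term_bound_halfplane) (use that in auto)
      also have "\<dots> \<le> A * real (Suc n) powr (- 1 - eps / 2)"
        unfolding A_def by (intro mult_right_mono mult_mono powr_mono2) (use * ** in \<open>auto simp: eps_def\<close>)
      finally show ?thesis .
    qed
    moreover have "summable (\<lambda>n. A * real (Suc n) powr (- 1 - eps / 2))"
      by (intro summable_mult summable_zeta_term_const)
    ultimately show "\<exists>d h. 0 < d \<and> summable h \<and> (\<forall>\<^sub>F n in sequentially. \<forall>y\<in>ball x d \<inter> zeta_halfplane. norm (zeta_term y n) \<le> h n)"
      by (intro exI[of _ 1] exI[of _ "\<lambda>n. A * real (Suc n) powr (- 1 - eps / 2)"]) auto
  qed simp
  then obtain g g' where g: "\<And>x. x \<in> zeta_halfplane \<Longrightarrow> ((\<lambda>n. zeta_term x n) sums g x)"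
     "\<And>x. x \<in> zeta_halfplane \<Longrightarrow> (g has_field_derivative g' x) (at x)" by blast
  have "(\<lambda>s. 1 + g s) holomorphic_on zeta_halfplane"
    unfolding holomorphic_on_open[OF open_zeta_halfplane]
  proof safe
    fix x assume "x \<in> zeta_halfplane"
    then show "\<exists>f'. ((\<lambda>s. 1 + g s) has_field_derivative f') (at x)"
      using g(2) by (intro exI[of _ "g' x"]) (auto intro!: derivative_eq_intros)
  qed
  moreover have "zeta_num s = 1 + g s" if "s \<in> zeta_halfplane" for s
    using g(1)[OF that] by (simp add: zeta_num_def sums_iff)
  ultimately show ?thesis by (simp cong: holomorphic_cong)
qed

text \<open>At the pole \<open>s = 1\<close> the value is 0, since division by zero yields zero.\<close>
definition zeta :: "complex \<Rightarrow> complex" where "zeta s = zeta_num s / (s - 1)"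

lemma holomorphic_zeta: "zeta holomorphic_on (zeta_halfplane - {1})"
  unfolding zeta_def by (intro holomorphic_intros holomorphic_on_subset[OF holomorphic_zeta_num]) auto

lemma zeta_bound:
  assumes "s \<in> zeta_halfplane" "s \<noteq> 1"
  shows "norm (zeta s) \<le> 1 / norm (s - 1) + 2 * zeta_term_const * norm s powr eps"
proof -
  have "norm (zeta_num s) \<le> 1 + norm (zeta_num s - 1)"
    using norm_triangle_sub[of "zeta_num s" 1] by simp
  also note zeta_num_bound[OF assms(1)]
  finally have "norm (zeta_num s) / norm (s - 1) \<le> (1 + 2 * zeta_term_const * norm (s - 1) * norm s powr eps) / norm (s - 1)"
    by (intro divide_right_mono) auto
  also have "\<dots> = 1 / norm (s - 1) + 2 * zeta_term_const * norm s powr eps"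
    using assms by (simp add: field_simps)
  finally show ?thesis by (simp add: zeta_def norm_divide)
qed

lemma zeta_sums:
  assumes "Re s > 1"
  shows "(\<lambda>n. of_nat (Suc n) powr (- s)) sums zeta s"
proof -
  have s: "s \<in> zeta_halfplane" "s \<noteq> 1" using assms by (auto simp: zeta_halfplane_def eps_def)
  have "(\<lambda>n. of_nat (Suc n) powr (1 - s) :: complex) \<longlonglongrightarrow> 0"
  proof (rule tendsto_norm_zero_cancel)
    have "(\<lambda>n. real (Suc n) powr (1 - Re s)) \<longlonglongrightarrow> 0"
      by (rule tendsto_neg_powr) (use assms in \<open>auto intro!: filterlim_compose[OF filterlim_real_sequentially filterlim_Suc] simp del: of_nat_Suc\<close>)
    then show "(\<lambda>n. norm (of_nat (Suc n) powr (1 - s) :: complex)) \<longlonglongrightarrow> 0"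
      by (subst norm_of_nat_powr) auto
  qed
  then have "(\<lambda>n. of_nat (Suc (Suc n)) powr (1 - s) - of_nat (Suc n) powr (1 - s) :: complex) sums (0 - of_nat (Suc 0) powr (1 - s))"
    by (rule telescope_sums)
  with summable_sums[OF summable_zeta_term[OF s(1)]]
  have "(\<lambda>n. zeta_term s n - (of_nat (Suc (Suc n)) powr (1 - s) - of_nat (Suc n) powr (1 - s) :: complex)) sums
      ((\<Sum>n. zeta_term s n) - (0 - of_nat (Suc 0) powr (1 - s)))"
    by (rule sums_diff)
  then have "(\<lambda>n. (s - 1) * of_nat (Suc n) powr (- s)) sums zeta_num s"
    by (simp add: zeta_term_def zeta_num_def add.commute)
  then have "(\<lambda>n. (s - 1) * of_nat (Suc n) powr (- s) / (s - 1)) sums (zeta_num s / (s - 1))"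
    by (rule sums_divide)
  then show ?thesis using s by (simp add: zeta_def)
qed

section \<open>Euler products and the 3-4-1 inequality\<close>

text \<open>Tannery's theorem with majorant n^(-Re s). Multiplying by or expanding a product over
  the primes up to N restricts a Dirichlet series to the indices with \<open>P N n\<close>; for
  fixed n this condition is stationary from N = n on.\<close>

lemma suminf_restrict_powr_tendsto:
  fixes c :: "nat \<Rightarrow> complex" and P :: "nat \<Rightarrow> nat \<Rightarrow> bool"
  assumes s: "Re s > 1" and c: "\<And>n. norm (c n) \<le> 1" and P: "\<And>N n. n \<le> N \<Longrightarrow> P N n \<longleftrightarrow> Q n"
  shows "(\<lambda>N. \<Sum>n. if P N n then c n * of_nat n powr (- s) else 0) \<longlonglongrightarrow>
           (\<Sum>n. if Q n then c n * of_nat n powr (- s) else 0)"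
proof -
  have "eventually (\<lambda>N. summable (\<lambda>n. norm (if P N n then c n * of_nat n powr (- s) else 0))) sequentially \<and>
     summable (\<lambda>n. norm (if Q n then c n * of_nat n powr (- s) else 0)) \<and>
     ((\<lambda>N. \<Sum>n. if P N n then c n * of_nat n powr (- s) else 0) \<longlongrightarrow>
           (\<Sum>n. if Q n then c n * of_nat n powr (- s) else 0)) sequentially"
  proof (rule tannerys_theorem[where M = "\<lambda>n. real n powr (- Re s)"])
    fix k
    have "\<forall>\<^sub>F N in sequentially. (if P N k then c k * of_nat k powr (- s) else 0) = (if Q k then c k * of_nat k powr (- s) else 0)"
      using eventually_ge_at_top[of k] by eventually_elim (use P in auto)
    then show "(\<lambda>N. if P N k then c k * of_nat k powr (- s) else 0) \<longlonglongrightarrow> (if Q k then c k * of_nat k powr (- s) else 0)"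
      by (rule tendsto_eventually)
  next
    have "norm (if P N k then c k * of_nat k powr (- s) else 0) \<le> real k powr (- Re s)" for N k
    proof (cases "k = 0")
      case False
      have "norm (c k) * real k powr (- Re s) \<le> 1 * real k powr (- Re s)"
        by (intro mult_right_mono c) auto
      with False show ?thesis by (auto simp: norm_mult norm_of_nat_powr)
    qed auto
    then show "\<forall>\<^sub>F (k, N) in sequentially \<times>\<^sub>F sequentially.
       norm (if P N k then c k * of_nat k powr (- s) else 0) \<le> real k powr (- Re s)"
      by (intro always_eventually) auto
  qed (use s in \<open>auto simp: summable_real_powr_iff\<close>)
  then show ?thesis by blast
qed

lemma summable_powr:
  fixes c :: "nat \<Rightarrow> complex"
  assumes s: "Re s > 1" and c: "\<And>n. norm (c n) \<le> 1"
  shows "summable (\<lambda>n. norm (c n * of_nat n powr (- s)))"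
proof (rule summable_comparison_test')
  show "summable (\<lambda>n. real n powr (- Re s))" using s by (subst summable_real_powr_iff) auto
  show "norm (norm (c n * of_nat n powr (- s))) \<le> real n powr (- Re s)" if "n \<ge> 0" for n
  proof (cases "n = 0")
    case False
    have "norm (c n) * real n powr (- Re s) \<le> 1 * real n powr (- Re s)"
      by (intro mult_right_mono c) auto
    with False show ?thesis by (auto simp: norm_mult norm_of_nat_powr)
  qed auto
qed

text \<open>The reciprocal of the usual partial Euler product: multiplying zeta by it sieves the
  series, and expanding it produces the Moebius function.\<close>

definition euler :: "nat set \<Rightarrow> complex \<Rightarrow> complex" where
  "euler P s = (\<Prod>p\<in>P. 1 - of_nat p powr (- s))"

lemma of_nat_mult_powr:
  "(of_nat (m * n) :: complex) powr s = of_nat m powr s * of_nat n powr s"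
  using powr_times_real[of "of_nat m" "of_nat n" s] by simp

lemma zeta_has_sum:
  assumes "Re s > 1"
  shows "((\<lambda>n. of_nat n powr (- s)) has_sum zeta s) {0<..}"
proof -
  have "(\<lambda>n. of_nat (Suc n) powr (- s)) sums zeta s" by (rule zeta_sums[OF assms])
  moreover have "summable (\<lambda>n. norm (of_nat (Suc n) powr (- s) :: complex))"
    using summable_powr[OF assms, of "\<lambda>_. 1"] by (subst summable_Suc_iff) simp
  ultimately have "((\<lambda>n. of_nat (Suc n) powr (- s)) has_sum zeta s) UNIV"
    by (intro norm_summable_imp_has_sum)
  also have "?this \<longleftrightarrow> ?thesis"
    by (rule has_sum_reindex_bij_witness[of _ "\<lambda>n. n - 1" Suc]) auto
  finally show ?thesis .
qed

text \<open>Sieve of Eratosthenes: multiplying the series over \<open>A\<close> by 1 - p^(-s)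
  subtracts the series over p A, which removes exactly the multiples of p.\<close>

lemma zeta_euler_has_sum:
  assumes s: "Re s > 1" and "finite P" "\<And>p. p \<in> P \<Longrightarrow> prime p"
  shows "((\<lambda>n. of_nat n powr (- s)) has_sum (zeta s * euler P s)) {n. n > 0 \<and> (\<forall>p\<in>P. \<not> p dvd n)}"
  using assms(2,3)
proof (induction P rule: finite_induct)
  case empty
  then show ?case using zeta_has_sum[OF s] by (simp add: euler_def greaterThan_def)
next
  case (insert p P)
  define A where "A = {n. n > 0 \<and> (\<forall>p\<in>P. \<not> p dvd n)}"
  have IH: "((\<lambda>n. of_nat n powr (- s)) has_sum (zeta s * euler P s)) A"
    using insert by (simp add: A_def)
  have p: "prime p" using insert by auto
  then have p0: "p > 0" by (simp add: prime_gt_0_nat)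
  \<comment> \<open>Multiplying by p does not affect divisibility by the primes sieved before, so p
    A consists of all multiples of p in A.\<close>
  have dvd: "q dvd p * n \<longleftrightarrow> q dvd n" if "q \<in> P" for q n
    using that insert p by (metis insert_iff prime_dvd_mult_iff primes_dvd_imp_eq)
  have "((\<lambda>n. of_nat p powr (- s) * of_nat n powr (- s)) has_sum (of_nat p powr (- s) * (zeta s * euler P s))) A"
    by (rule has_sum_cmult_right[OF IH])
  also have "?this \<longleftrightarrow> ((\<lambda>n. of_nat n powr (- s)) has_sum (of_nat p powr (- s) * (zeta s * euler P s))) ((\<lambda>n. p * n) ` A)"
    using p0 by (subst has_sum_reindex) (auto simp: inj_on_def o_def of_nat_mult_powr simp del: of_nat_mult)
  finally have "((\<lambda>n. of_nat n powr (- s)) has_sum (zeta s * euler P s - of_nat p powr (- s) * (zeta s * euler P s)))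
     (A - (\<lambda>n. p * n) ` A)"
    by (intro has_sum_Diff IH) (use p0 dvd in \<open>auto simp: A_def\<close>)
  also have "A - (\<lambda>n. p * n) ` A = {n. n > 0 \<and> (\<forall>q\<in>insert p P. \<not> q dvd n)}"
  proof -
    have "n \<in> (*) p ` A \<longleftrightarrow> p dvd n" if "n \<in> A" for n
    proof
      assume "p dvd n"
      then obtain m where m: "n = p * m" by auto
      with that have "m \<in> A" using dvd[of _ m] by (auto simp: A_def)
      with m show "n \<in> (*) p ` A" by auto
    qed auto
    then show ?thesis by (auto simp: A_def)
  qed
  also have "zeta s * euler P s - of_nat p powr (- s) * (zeta s * euler P s) = zeta s * euler (insert p P) s"
    using insert by (simp add: euler_def algebra_simps)
  finally show ?case .
qed

definition primes_le :: "nat \<Rightarrow> nat set" where "primes_le N = {p. prime p \<and> p \<le> N}"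

lemma finite_primes_le [simp]: "finite (primes_le N)"
  unfolding primes_le_def by (rule finite_subset[of _ "{..N}"]) auto

lemma has_sum_imp_suminf:
  fixes f :: "nat \<Rightarrow> complex"
  assumes "(f has_sum S) A"
  shows "S = (\<Sum>n. if n \<in> A then f n else 0)"
proof -
  have "((\<lambda>n. if n \<in> A then f n else 0) has_sum S) UNIV"
    using assms by (subst has_sum_cong_neutral[where T = A and g = f]) auto
  then show ?thesis by (auto dest: has_sum_imp_sums simp: sums_iff)
qed

text \<open>Every n > 1 with n <= N has a prime factor at most N, so among these indices the sieve
  leaves only 1.\<close>

lemma zeta_euler_tendsto:
  assumes s: "Re s > 1"
  shows "(\<lambda>N. zeta s * euler (primes_le N) s) \<longlonglongrightarrow> 1"
proof -
  have "(\<lambda>N. \<Sum>n. if n > 0 \<and> (\<forall>p\<in>primes_le N. \<not> p dvd n) then 1 * of_nat n powr (- s) else 0) \<longlonglongrightarrow>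
           (\<Sum>n. if n = 1 then 1 * of_nat n powr (- s) else (0::complex))"
  proof (rule suminf_restrict_powr_tendsto[OF s])
    fix N n :: nat assume "n \<le> N"
    show "(n > 0 \<and> (\<forall>p\<in>primes_le N. \<not> p dvd n)) \<longleftrightarrow> n = 1"
    proof (cases "n = 1 \<or> n = 0")
      case False
      then obtain p where "prime p" "p dvd n" using prime_factor_nat by blast
      moreover from this have "p \<le> n" using False by (auto intro: dvd_imp_le)
      ultimately show ?thesis using False \<open>n \<le> N\<close> by (auto simp: primes_le_def)
    qed (auto simp: primes_le_def)
  qed auto
  also have "(\<Sum>n. if n = 1 then 1 * of_nat n powr (- s) else (0::complex)) = 1"
    by (subst suminf_finite[of "{1}"]) auto
  also have "(\<lambda>N. \<Sum>n. if n > 0 \<and> (\<forall>p\<in>primes_le N. \<not> p dvd n) then 1 * of_nat n powr (- s) else 0) =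
     (\<lambda>N. zeta s * euler (primes_le N) s)"
  proof
    fix N
    show "(\<Sum>n. if n > 0 \<and> (\<forall>p\<in>primes_le N. \<not> p dvd n) then 1 * of_nat n powr (- s) else 0) = zeta s * euler (primes_le N) s"
    proof -
      have "(\<Sum>n. if n \<in> {n. n > 0 \<and> (\<forall>p\<in>primes_le N. \<not> p dvd n)} then of_nat n powr (- s) else 0) = zeta s * euler (primes_le N) s"
        by (rule has_sum_imp_suminf[symmetric], rule zeta_euler_has_sum[OF s]) (simp, simp add: primes_le_def)
      then show ?thesis by (simp only: mem_Collect_eq mult_1)
    qed
  qed
  finally show ?thesis .
qed

section \<open>The Dirichlet series of the Moebius function\<close>

lemma mu_0 [simp]: "mu 0 = 0" and mu_1 [simp]: "mu (Suc 0) = 1"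
  by (auto simp: Defs.moebius_def)

text \<open>The arithmetic behind both the expansion of the Euler product and the later recursion
  over the multiples of p.\<close>

lemma mu_prime_mult:
  assumes p: "prime p"
  shows "mu (p * n) = (if p dvd n then 0 else - mu n)"
proof (cases "p dvd n")
  case True
  then have "p ^ 2 dvd p * n" by (simp add: power2_eq_square mult_dvd_mono)
  then have "\<not> squarefree (p * n)" using p by (intro not_squarefreeI) auto
  then show ?thesis using True by (simp add: Defs.moebius_def)
next
  case False
  then have cop: "coprime p n" using p by (simp add: prime_imp_coprime)
  have n0: "n \<noteq> 0" using False by (intro notI) auto
  have "squarefree (p * n) \<longleftrightarrow> squarefree n"
    using squarefree_mult_coprime[OF cop squarefree_prime[OF p]] squarefree_multD(2) by blast
  moreover have "prime_factors (p * n) = insert p (prime_factors n)"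
    using p n0 by (auto simp: prime_factors_product prime_prime_factors)
  moreover have "p \<notin> prime_factors n" using False by auto
  ultimately show ?thesis using False by (simp add: Defs.moebius_def)
qed

lemma abs_mu_le: "\<bar>mu n\<bar> \<le> 1"
  by (simp add: Defs.moebius_def)

lemma norm_mu_le: "norm (of_int (mu n) :: complex) \<le> 1"
  using abs_mu_le[of n] by simp

lemma mu_eq_0: "\<not> squarefree n \<Longrightarrow> mu n = 0"
  by (simp add: Defs.moebius_def)

text \<open>Adjoining a prime p turns the index set A into the disjoint union of A and p A, and on p
  A the Moebius function changes sign, which matches the new factor 1 - p^(-s).\<close>

lemma euler_mu_has_sum:
  assumes "finite P" "\<And>p. p \<in> P \<Longrightarrow> prime p"
  shows "((\<lambda>n. of_int (mu n) * of_nat n powr (- s)) has_sum euler P s) {n. squarefree n \<and> prime_factors n \<subseteq> P}"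
  using assms
proof (induction P rule: finite_induct)
  case empty
  have "{n::nat. squarefree n \<and> prime_factors n \<subseteq> {}} = {1}"
    using prime_factorization_empty_iff by (auto simp: set_mset_eq_empty_iff)
  then show ?case by (simp only:) (rule has_sum_finiteI, auto simp: euler_def)
next
  case (insert p P)
  define A where "A = {n. squarefree n \<and> prime_factors n \<subseteq> P}"
  have IH: "((\<lambda>n. of_int (mu n) * of_nat n powr (- s)) has_sum euler P s) A"
    using insert by (simp add: A_def)
  have p: "prime p" using insert by auto
  have pf: "prime_factors (p * n) = insert p (prime_factors n)" if "n \<noteq> 0" for n
    using p that by (auto simp: prime_factors_product prime_prime_factors)
  have ndvd: "\<not> p dvd n" if "n \<in> A" for n
  proof
    assume "p dvd n"
    moreover have "n \<noteq> 0" using that by (intro notI) (simp add: A_def)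
    ultimately have "p \<in> prime_factors n" using p by (simp add: prime_factors_dvd)
    with that insert.hyps show False by (auto simp: A_def)
  qed
  have "((\<lambda>n. - (of_nat p powr (- s)) * (of_int (mu n) * of_nat n powr (- s))) has_sum (- (of_nat p powr (- s)) * euler P s)) A"
    by (rule has_sum_cmult_right[OF IH])
  also have "?this \<longleftrightarrow> ((\<lambda>n. of_int (mu (p * n)) * of_nat (p * n) powr (- s)) has_sum (- (of_nat p powr (- s)) * euler P s)) A"
    by (rule has_sum_cong) (use ndvd in \<open>auto simp: mu_prime_mult[OF p] of_nat_mult_powr simp del: of_nat_mult\<close>)
  also have "\<dots> \<longleftrightarrow> ((\<lambda>n. of_int (mu n) * of_nat n powr (- s)) has_sum (- (of_nat p powr (- s)) * euler P s)) ((\<lambda>n. p * n) ` A)"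
    using p by (subst has_sum_reindex) (auto simp: inj_on_def o_def)
  finally have "((\<lambda>n. of_int (mu n) * of_nat n powr (- s)) has_sum (euler P s + - (of_nat p powr (- s)) * euler P s))
     (A \<union> (\<lambda>n. p * n) ` A)"
    by (intro has_sum_Un_disjoint IH) (auto dest: ndvd)
  also have "A \<union> (\<lambda>n. p * n) ` A = {n. squarefree n \<and> prime_factors n \<subseteq> insert p P}"
  proof (intro equalityI subsetI)
    fix k assume "k \<in> A \<union> (\<lambda>n. p * n) ` A"
    then show "k \<in> {n. squarefree n \<and> prime_factors n \<subseteq> insert p P}"
    proof
      assume "k \<in> (\<lambda>n. p * n) ` A"
      then obtain n where n: "n \<in> A" "k = p * n" by blast
      then have "coprime p n" "squarefree n" using ndvd p by (auto simp: A_def intro: prime_imp_coprime)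
      then have "squarefree k" using p unfolding n(2)
        by (intro squarefree_mult_coprime) (auto intro: squarefree_prime)
      moreover have "n \<noteq> 0" using n by (intro notI) (simp add: A_def)
      then have "prime_factors k = insert p (prime_factors n)" using pf[of n] n(2) by simp
      ultimately show ?thesis using n(1) unfolding A_def by blast
    qed (auto simp: A_def)
  next
    fix n assume "n \<in> {n. squarefree n \<and> prime_factors n \<subseteq> insert p P}"
    then have n: "squarefree n" "prime_factors n \<subseteq> insert p P" by auto
    show "n \<in> A \<union> (\<lambda>n. p * n) ` A"
    proof (cases "n \<in> (\<lambda>n. p * n) ` A")
      case False
    have n0: "n \<noteq> 0" using n(1) by (intro notI) auto
    \<comment> \<open>If n = p m is squarefree then p does not divide m, so m lies in A and n in p
      A, contrary to the case assumption.\<close>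
    have "\<not> p dvd n"
    proof
      assume "p dvd n"
      then obtain m where m: "n = p * m" by auto
      have "squarefree m" using n(1) m squarefree_multD(2) by blast
      have "\<not> p dvd m"
      proof
        assume "p dvd m"
        then have "p ^ 2 dvd n" using m by (simp add: power2_eq_square mult_dvd_mono)
        then have "p dvd 1" using n(1) squarefreeD by blast
        then show False using p by simp
      qed
      then have "prime_factors m \<subseteq> P"
        using n(2) n0 m pf[of m] by auto
      with \<open>squarefree m\<close> have "m \<in> A" by (simp add: A_def)
      with False m show False by blast
    qed
    then have "p \<notin> prime_factors n" by auto
    then show ?thesis using n by (auto simp: A_def)
    qed auto
  qed
  also have "euler P s + - (of_nat p powr (- s)) * euler P s = euler (insert p P) s"
    using insert by (simp add: euler_def algebra_simps)
  finally show ?case .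
qed

lemma euler_tendsto_mu:
  assumes s: "Re s > 1"
  shows "(\<lambda>N. euler (primes_le N) s) \<longlonglongrightarrow> (\<Sum>n. of_int (mu n) * of_nat n powr (- s))"
proof -
  have "(\<lambda>N. \<Sum>n. if squarefree n \<and> prime_factors n \<subseteq> primes_le N then of_int (mu n) * of_nat n powr (- s) else 0) \<longlonglongrightarrow>
           (\<Sum>n. if squarefree n then of_int (mu n) * of_nat n powr (- s) else (0::complex))"
  proof (rule suminf_restrict_powr_tendsto[OF s norm_mu_le])
    fix N n :: nat assume "n \<le> N"
    show "(squarefree n \<and> prime_factors n \<subseteq> primes_le N) \<longleftrightarrow> squarefree n"
    proof safe
      fix q assume *: "squarefree n" "q \<in> prime_factors n"
      then have "n > 0" by (intro Nat.gr0I) auto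
      with * have "q \<le> n" by (auto simp: prime_factors_dvd intro: dvd_imp_le)
      then show "q \<in> primes_le N" using * \<open>n \<le> N\<close> by (auto simp: primes_le_def prime_factors_dvd)
    qed
  qed
  also have "(\<lambda>n. if squarefree n then of_int (mu n) * of_nat n powr (- s) else (0::complex)) = (\<lambda>n. of_int (mu n) * of_nat n powr (- s))"
    by (auto simp: mu_eq_0)
  also have "(\<lambda>N. \<Sum>n. if squarefree n \<and> prime_factors n \<subseteq> primes_le N then of_int (mu n) * of_nat n powr (- s) else 0) =
     (\<lambda>N. euler (primes_le N) s)"
  proof
    fix N
    show "(\<Sum>n. if squarefree n \<and> prime_factors n \<subseteq> primes_le N then of_int (mu n) * of_nat n powr (- s) else 0) = euler (primes_le N) s"
    proof -
      have "(\<Sum>n. if n \<in> {n. squarefree n \<and> prime_factors n \<subseteq> primes_le N} then of_int (mu n) * of_nat n powr (- s) else 0) = euler (primes_le N) s"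
        by (rule has_sum_imp_suminf[symmetric], rule euler_mu_has_sum) (simp, simp add: primes_le_def)
      then show ?thesis by (simp only: mem_Collect_eq)
    qed
  qed
  finally show ?thesis .
qed

text \<open>The sequence \<open>zeta s * euler (primes_le N) s\<close> is evaluated in two ways:
  sieving gives the limit 1, expanding the product gives the left-hand side.\<close>

lemma zeta_mu_sum:
  assumes s: "Re s > 1"
  shows "zeta s * (\<Sum>n. of_int (mu n) * of_nat n powr (- s)) = 1"
  using tendsto_mult[OF tendsto_const[of "zeta s"] euler_tendsto_mu[OF s]] zeta_euler_tendsto[OF s]
  by (rule LIMSEQ_unique)

lemma zeta_nonzero: "Re s > 1 \<Longrightarrow> zeta s \<noteq> 0"
  using zeta_mu_sum[of s] by auto

section \<open>The 3-4-1 inequality\<close>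

lemma ln_norm_one_minus_sums:
  assumes "norm z < 1"
  shows "(\<lambda>n. - (Re (z ^ n) / real n)) sums ln (norm (1 - z))"
proof -
  have "1 - z \<noteq> 0" using assms by auto
  \<comment> \<open>The logarithm series starts at n = 1; the summand for n = 0 is a division by
    zero and hence 0.\<close>
  have "(\<lambda>n. - (z ^ n) / of_nat n) sums ln (1 - z)"
    using Ln_series'[of "- z"] assms by simp
  then have "(\<lambda>n. Re (- (z ^ n) / of_nat n)) sums Re (ln (1 - z))"
    by (rule sums_Re)
  then show ?thesis using \<open>1 - z \<noteq> 0\<close> by (simp add: Re_Ln Re_divide_of_nat)
qed

text \<open>Taking logarithms, the n-th coefficient is -(r^n / n) (3 + 4 Re w + Re w^2) with w = z^n
  on the unit circle, and 3 + 4 cos x + cos 2x = 2 (1 + cos x)^2 >= 0.\<close>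

lemma norm_341:
  fixes r :: real and z :: complex
  assumes r: "0 \<le> r" "r < 1" and z: "norm z = 1"
  shows "norm (1 - of_real r :: complex) ^ 3 * norm (1 - of_real r * z) ^ 4 * norm (1 - of_real r * z ^ 2) \<le> 1"
proof -
  have nz: "norm (1 - of_real r * w) > 0" if "norm w = 1" for w :: complex
  proof -
    have "norm (of_real r * w) < 1" using that r by (simp add: norm_mult)
    then have "1 - of_real r * w \<noteq> 0" by auto
    then show ?thesis by simp
  qed
  have S: "(\<lambda>n. - (Re ((of_real r * w) ^ n) / real n)) sums ln (norm (1 - of_real r * w))" if "norm w = 1" for w
    by (rule ln_norm_one_minus_sums) (use that r in \<open>simp add: norm_mult\<close>)
  let ?t = "\<lambda>w n. - (Re ((of_real r * w) ^ n) / real n)"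
  have sums: "(\<lambda>n. 3 * ?t 1 n + 4 * ?t z n + ?t (z ^ 2) n) sums
     (3 * ln (norm (1 - of_real r * 1 :: complex)) + 4 * ln (norm (1 - of_real r * z)) + ln (norm (1 - of_real r * z ^ 2)))"
    by (rule sums_add[OF sums_add[OF sums_mult[OF S] sums_mult[OF S]] S]) (use z in \<open>auto simp: norm_power\<close>)
  have neg: "3 * ?t 1 n + 4 * ?t z n + ?t (z ^ 2) n \<le> 0" for n
  proof -
    define w where "w = z ^ n"
    have w: "(Re w)\<^sup>2 + (Im w)\<^sup>2 = 1"
      using z by (simp add: w_def norm_power flip: cmod_power2)
    have e: "Re ((of_real r * v) ^ n) = r ^ n * Re (v ^ n)" for v
      by (simp add: power_mult_distrib flip: of_real_power)
    have "3 * ?t 1 n + 4 * ?t z n + ?t (z ^ 2) n = - (r ^ n / real n) * (3 + 4 * Re w + Re (w\<^sup>2))"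
    proof -
      have "(z ^ 2) ^ n = w ^ 2" unfolding w_def by (metis mult.commute power_mult)
      then show ?thesis unfolding e by (simp add: w_def[symmetric] algebra_simps add_divide_distrib)
    qed
    also have "3 + 4 * Re w + Re (w\<^sup>2) = 2 * (1 + Re w)\<^sup>2"
    proof -
      have "Re (w\<^sup>2) = (Re w)\<^sup>2 - (Im w)\<^sup>2" by (simp add: power2_eq_square)
      with w show ?thesis by (simp add: power2_sum)
    qed
    also have "- (r ^ n / real n) * (2 * (1 + Re w)\<^sup>2) \<le> 0"
      using r by (simp add: mult_nonneg_nonneg)
    finally show ?thesis .
  qed
  have L: "3 * ln a + 4 * ln b + ln c = ln (a ^ 3 * b ^ 4 * c)" if "a > 0" "b > 0" "c > 0" for a b c :: real
    using that by (simp add: ln_mult ln_realpow)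
  have "3 * ln (norm (1 - of_real r * 1 :: complex)) + 4 * ln (norm (1 - of_real r * z)) + ln (norm (1 - of_real r * z ^ 2)) \<le> 0"
    by (rule sums_le[OF neg sums sums_zero])
  also have "3 * ln (norm (1 - of_real r * 1 :: complex)) + 4 * ln (norm (1 - of_real r * z)) + ln (norm (1 - of_real r * z ^ 2))
     = ln (norm (1 - of_real r * 1 :: complex) ^ 3 * norm (1 - of_real r * z) ^ 4 * norm (1 - of_real r * z ^ 2))"
    by (rule L; intro nz) (use z in \<open>simp_all add: norm_power\<close>)
  finally have "norm (1 - of_real r * 1 :: complex) ^ 3 * norm (1 - of_real r * z) ^ 4 * norm (1 - of_real r * z ^ 2) \<le> 1"
    by (subst (asm) ln_le_zero_iff) (intro mult_pos_pos zero_less_power nz, use z in \<open>simp_all add: norm_power\<close>)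
  then show ?thesis by simp
qed

text \<open>\<open>norm_341\<close> for each prime, with r = p^(-\<sigma>) and z = p^(-it), so that
  z^2 belongs to 2t. The bound is from above because \<open>euler\<close> is the reciprocal
  product.\<close>

lemma euler_341:
  assumes \<sigma>: "\<sigma> > 1" and P: "\<And>p. p \<in> P \<Longrightarrow> prime p"
  shows "norm (euler P (of_real \<sigma>)) ^ 3 * norm (euler P (Complex \<sigma> t)) ^ 4 * norm (euler P (Complex \<sigma> (2 * t))) \<le> 1"
proof -
  have "norm (1 - of_nat p powr (- of_real \<sigma>) :: complex) ^ 3 * norm (1 - of_nat p powr (- Complex \<sigma> t)) ^ 4 * norm (1 - of_nat p powr (- Complex \<sigma> (2 * t))) \<le> 1"
    if "p \<in> P" for p
  proof -
    have p: "real p > 1" using P[OF that] prime_gt_1_nat by auto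
    have pw: "of_nat p powr (- Complex \<sigma> u) = complex_of_real (p powr (- \<sigma>)) * exp (- (\<i> * of_real (u * ln p)))" for u
    proof -
      have s: "- Complex \<sigma> u * of_real (ln p) = of_real (- \<sigma> * ln p) + - (\<i> * of_real (u * ln p))"
        by (simp add: complex_eq_iff)
      have "Ln (of_nat p) = of_real (ln p)"
        using p Ln_of_real[of "real p"] by simp
      then have "of_nat p powr (- Complex \<sigma> u) = exp (- Complex \<sigma> u * of_real (ln p))"
        using p by (simp add: powr_def)
      also have "\<dots> = complex_of_real (p powr (- \<sigma>)) * exp (- (\<i> * of_real (u * ln p)))"
        unfolding s exp_add using p by (simp add: powr_def exp_of_real del: of_real_mult of_real_minus)
      finally show ?thesis .
    qed
    define z where "z = exp (- (\<i> * complex_of_real (t * ln p)))"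
    have nz: "norm z = 1" by (simp add: z_def)
    have 1: "of_nat p powr (- of_real \<sigma>) = complex_of_real (p powr (- \<sigma>))"
      using powr_of_real[of p "-\<sigma>"] by simp
    have 2: "of_nat p powr (- Complex \<sigma> t) = complex_of_real (p powr (- \<sigma>)) * z"
      unfolding pw z_def ..
    have 3: "of_nat p powr (- Complex \<sigma> (2 * t)) = complex_of_real (p powr (- \<sigma>)) * z ^ 2"
    proof -
      have "- (\<i> * complex_of_real (2 * t * ln p)) = 2 * (- (\<i> * complex_of_real (t * ln p)))" by simp
      then show ?thesis unfolding pw z_def by (metis exp_double)
    qed
    show ?thesis unfolding 1 2 3
    proof (rule norm_341)
      show "p powr - \<sigma> < 1" using p \<sigma> by (simp add: powr_less_one)
    qed (simp_all add: nz)
  qed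
  then have "(\<Prod>p\<in>P. norm (1 - of_nat p powr (- of_real \<sigma>) :: complex) ^ 3 * norm (1 - of_nat p powr (- Complex \<sigma> t)) ^ 4 * norm (1 - of_nat p powr (- Complex \<sigma> (2 * t)))) \<le> 1"
    by (intro prod_le_1) auto
  then show ?thesis by (simp add: euler_def prod.distrib prod_power_distrib flip: prod_norm)
qed

text \<open>Multiplying \<open>euler_341\<close> by the three zeta factors bounds the product of the
  terms \<open>?e N\<close> by the product of zeta values; as N grows, each \<open>?e N\<close>
  tends to 1.\<close>

lemma zeta_341:
  assumes \<sigma>: "\<sigma> > 1"
  shows "norm (zeta (of_real \<sigma>)) ^ 3 * norm (zeta (Complex \<sigma> t)) ^ 4 * norm (zeta (Complex \<sigma> (2 * t))) \<ge> 1"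
proof -
  let ?e = "\<lambda>N s. norm (zeta s * euler (primes_le N) s)"
  have "(\<lambda>N. ?e N (of_real \<sigma>) ^ 3 * ?e N (Complex \<sigma> t) ^ 4 * ?e N (Complex \<sigma> (2 * t))) \<longlonglongrightarrow> norm (1::complex) ^ 3 * norm (1::complex) ^ 4 * norm (1::complex)"
    by (intro tendsto_intros zeta_euler_tendsto) (use \<sigma> in auto)
  moreover have "?e N (of_real \<sigma>) ^ 3 * ?e N (Complex \<sigma> t) ^ 4 * ?e N (Complex \<sigma> (2 * t)) \<le>
      norm (zeta (of_real \<sigma>)) ^ 3 * norm (zeta (Complex \<sigma> t)) ^ 4 * norm (zeta (Complex \<sigma> (2 * t)))" for N
  proof -
    have "?e N (of_real \<sigma>) ^ 3 * ?e N (Complex \<sigma> t) ^ 4 * ?e N (Complex \<sigma> (2 * t)) =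
      (norm (zeta (of_real \<sigma>)) ^ 3 * norm (zeta (Complex \<sigma> t)) ^ 4 * norm (zeta (Complex \<sigma> (2 * t)))) *
      (norm (euler (primes_le N) (of_real \<sigma>)) ^ 3 * norm (euler (primes_le N) (Complex \<sigma> t)) ^ 4 * norm (euler (primes_le N) (Complex \<sigma> (2 * t))))"
      by (simp add: norm_mult power_mult_distrib)
    also have "\<dots> \<le> (norm (zeta (of_real \<sigma>)) ^ 3 * norm (zeta (Complex \<sigma> t)) ^ 4 * norm (zeta (Complex \<sigma> (2 * t)))) * 1"
      by (intro mult_left_mono euler_341 \<sigma>) (auto simp: primes_le_def)
    finally show ?thesis by simp
  qed
  ultimately have "norm (1::complex) ^ 3 * norm (1::complex) ^ 4 * norm (1::complex) \<le>
      norm (zeta (of_real \<sigma>)) ^ 3 * norm (zeta (Complex \<sigma> t)) ^ 4 * norm (zeta (Complex \<sigma> (2 * t)))"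
    by (intro LIMSEQ_le_const2) blast+
  then show ?thesis by simp
qed

section \<open>The reciprocal of the zeta function near the line with real part 1\<close>

text \<open>The size parameter of the height t: the bounds away from the pole near Re s = 1 are
  written as powers of it. Using 1 + |t| keeps it at least 1.\<close>

definition growth :: "real \<Rightarrow> real" where "growth t = (1 + \<bar>t\<bar>) powr eps"

lemma growth_ge_1: "growth t \<ge> 1"
  unfolding growth_def by (rule ge_one_powr_ge_zero) (auto simp: eps_def)

lemma growth_pos [simp]: "growth t > 0"
  using growth_ge_1[of t] by linarith

text \<open>Since eps <= 1, a factor a >= 1 inside the power costs at most a factor a
  outside.\<close>

lemma powr_eps_scale:
  assumes "a \<ge> 1" "0 \<le> x" "x \<le> a * (1 + \<bar>t\<bar>)"
  shows "x powr eps \<le> a * growth t"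
proof -
  have "x powr eps \<le> (a * (1 + \<bar>t\<bar>)) powr eps"
    by (rule powr_mono2) (use assms in \<open>auto simp: eps_def\<close>)
  also have "\<dots> = a powr eps * growth t" using assms by (simp add: powr_mult growth_def)
  also have "a powr eps \<le> a powr 1" using assms by (intro powr_mono) (auto simp: eps_def)
  finally show ?thesis using assms by (simp add: mult_right_mono)
qed

lemma growth_scale:
  assumes "1 + \<bar>u\<bar> \<le> 2 * (1 + \<bar>t\<bar>)"
  shows "growth u \<le> 2 * growth t"
  using powr_eps_scale[of 2 "1 + \<bar>u\<bar>" t] assms by (simp add: growth_def)

text \<open>The height condition bounds the pole term 1 / |s - 1| by 1 / \<tau>; with Re s <= 4 the
  other term of \<open>zeta_bound\<close> is of size \<open>growth (Im s)\<close>.\<close>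

lemma zeta_upper:
  assumes "\<tau> > 0"
  obtains K where "K \<ge> 1" "\<And>s. \<bar>Im s\<bar> \<ge> \<tau> \<Longrightarrow> Re s > 1 - eps / 2 \<Longrightarrow> Re s \<le> 4 \<Longrightarrow> norm (zeta s) \<le> K * growth (Im s)"
proof
  let ?K = "1 / \<tau> + 8 * zeta_term_const + 1"
  show "?K \<ge> 1" using assms zeta_term_const_nonneg by simp
  fix s assume s: "\<bar>Im s\<bar> \<ge> \<tau>" "Re s > 1 - eps / 2" "Re s \<le> 4"
  have s1: "s \<noteq> 1" "s \<in> zeta_halfplane" using s assms by (auto simp: zeta_halfplane_def)
  have "norm (zeta s) \<le> 1 / norm (s - 1) + 2 * zeta_term_const * norm s powr eps"
    by (rule zeta_bound) (use s1 in auto)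
  also have "\<tau> \<le> norm (s - 1)" using s(1) abs_Im_le_cmod[of "s - 1"] by simp
  then have "1 / norm (s - 1) \<le> 1 / \<tau>" using assms s1 by (intro divide_left_mono) (auto intro!: mult_pos_pos)
  also have "norm s powr eps \<le> 4 * growth (Im s)"
  proof (rule powr_eps_scale)
    have "norm s \<le> \<bar>Re s\<bar> + \<bar>Im s\<bar>" by (rule cmod_le)
    also have "\<bar>Re s\<bar> \<le> 4" using s by (auto simp: eps_def)
    finally show "norm s \<le> 4 * (1 + \<bar>Im s\<bar>)" by simp
  qed auto
  then have "2 * zeta_term_const * norm s powr eps \<le> 2 * zeta_term_const * (4 * growth (Im s))"
    using zeta_term_const_nonneg by (intro mult_left_mono) auto
  also have "1 / \<tau> + 2 * zeta_term_const * (4 * growth (Im s)) \<le> ?K * growth (Im s)"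
  proof -
    have "1 / \<tau> * 1 \<le> 1 / \<tau> * growth (Im s)" using assms growth_ge_1 by (intro mult_left_mono) auto
    then show ?thesis using less_imp_le[OF growth_pos[of "Im s"]] by (simp add: algebra_simps)
  qed
  finally show "norm (zeta s) \<le> ?K * growth (Im s)" by simp
qed

lemma zeta_deriv_upper:
  assumes "\<tau> > 0"
  obtains K where "K > 0" "\<And>s. \<bar>Im s\<bar> \<ge> \<tau> \<Longrightarrow> Re s \<ge> 1 - eps / 4 \<Longrightarrow> Re s \<le> 3 \<Longrightarrow> norm (deriv zeta s) \<le> K * growth (Im s)"
proof -
  from assms have "\<tau> / 2 > 0" by simp
  from zeta_upper[OF this] obtain K1 where K1: "K1 \<ge> 1"
    "\<And>s. \<bar>Im s\<bar> \<ge> \<tau> / 2 \<Longrightarrow> Re s > 1 - eps / 2 \<Longrightarrow> Re s \<le> 4 \<Longrightarrow> norm (zeta s) \<le> K1 * growth (Im s)" by blast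
  \<comment> \<open>A Cauchy radius independent of s: \<tau> / 2 keeps the disc away from the pole,
    and eps / 4 + eps / 8 < eps / 2 keeps it inside the half-plane.\<close>
  define r where "r = min (\<tau> / 2) (eps / 8)"
  have r: "r > 0" "r \<le> \<tau> / 2" "r \<le> eps / 8" "r \<le> 1" using assms by (auto simp: r_def eps_def)
  show ?thesis
  proof (rule that[of "3 * K1 / r"])
    show "3 * K1 / r > 0" using r K1 by simp
    fix s assume s: "\<bar>Im s\<bar> \<ge> \<tau>" "Re s \<ge> 1 - eps / 4" "Re s \<le> 3"
    have w: "\<bar>Im w\<bar> \<ge> \<tau> / 2 \<and> Re w > 1 - eps / 2 \<and> Re w \<le> 4 \<and> growth (Im w) \<le> 2 * growth (Im s)"
      if "w \<in> cball s r" for w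
    proof -
      have 1: "\<bar>Re w - Re s\<bar> \<le> r" "\<bar>Im w - Im s\<bar> \<le> r"
        using that abs_Re_le_cmod[of "w - s"] abs_Im_le_cmod[of "w - s"] by (auto simp: dist_norm norm_minus_commute)
      have "\<bar>Im w\<bar> \<le> \<bar>Im s\<bar> + r" using 1 by linarith
      then have "growth (Im w) \<le> 2 * growth (Im s)" using r(4) abs_ge_zero[of "Im s"] by (intro growth_scale, simp add: field_simps)
      then show ?thesis using 1 r s by (auto simp: eps_def)
    qed
    have sub: "cball s r \<subseteq> zeta_halfplane - {1}"
      using w assms by (force simp: zeta_halfplane_def)
    \<comment> \<open>\<open>growth\<close> at most doubles on the disc; 3 in place of 2 because
      Cauchy's bound asks for values in an open ball.\<close>
    have "norm ((deriv ^^ 1) zeta s) \<le> fact 1 * (3 * K1 * growth (Im s)) / r ^ 1"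
    proof (rule Cauchy_higher_deriv_bound)
      show "zeta holomorphic_on ball s r"
        by (rule holomorphic_on_subset[OF holomorphic_zeta]) (use sub ball_subset_cball in blast)
      show "continuous_on (cball s r) zeta"
        by (rule holomorphic_on_imp_continuous_on, rule holomorphic_on_subset[OF holomorphic_zeta]) (use sub in blast)
      show "zeta w' \<in> ball 0 (3 * K1 * growth (Im s))" if "w' \<in> ball s r" for w'
      proof -
        have w': "w' \<in> cball s r" using that by auto
        have "norm (zeta w') \<le> K1 * growth (Im w')" using K1(2) w[OF w'] by blast
        also have "\<dots> \<le> K1 * (2 * growth (Im s))" using w[OF w'] K1 by (intro mult_left_mono) auto
        also have "\<dots> < 3 * K1 * growth (Im s)" using K1(1) growth_pos[of "Im s"] by simp
        finally show ?thesis by simp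
      qed
    qed (use r in auto)
    then show "norm (deriv zeta s) \<le> 3 * K1 / r * growth (Im s)" by simp
  qed
qed

text \<open>\<open>zeta_341\<close> solved for its middle factor: the real point contributes at most
  A / (\<sigma> - 1), the point at height 2t at most 2 K \<open>growth t\<close>. As \<sigma> <= 3,
  the regular part at the real point is also a multiple of 1 / (\<sigma> - 1).\<close>

lemma zeta_power4_lower:
  assumes "\<tau> > 0"
  obtains c where "c > 0" "\<And>\<sigma> t. \<bar>t\<bar> \<ge> \<tau> \<Longrightarrow> 1 < \<sigma> \<Longrightarrow> \<sigma> \<le> 3 \<Longrightarrow> norm (zeta (Complex \<sigma> t)) ^ 4 \<ge> c * (\<sigma> - 1) ^ 3 / growth t"
proof -
  from zeta_upper[OF assms] obtain K where K: "K \<ge> 1"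
    "\<And>s. \<bar>Im s\<bar> \<ge> \<tau> \<Longrightarrow> Re s > 1 - eps / 2 \<Longrightarrow> Re s \<le> 4 \<Longrightarrow> norm (zeta s) \<le> K * growth (Im s)" by blast
  define A where "A = 1 + 12 * zeta_term_const"
  have A: "A > 0" using zeta_term_const_nonneg by (simp add: A_def)
  show ?thesis
  proof (rule that[of "1 / (A ^ 3 * (2 * K))"])
    show "1 / (A ^ 3 * (2 * K)) > 0" using A K by simp
    fix \<sigma> t :: real assume t: "\<bar>t\<bar> \<ge> \<tau>" "1 < \<sigma>" "\<sigma> \<le> 3"
    have 1: "norm (zeta (of_real \<sigma>)) \<le> A / (\<sigma> - 1)"
    proof -
      have "norm (zeta (of_real \<sigma>)) \<le> 1 / norm (of_real \<sigma> - 1 :: complex) + 2 * zeta_term_const * norm (of_real \<sigma> :: complex) powr eps"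
        by (rule zeta_bound) (use t in \<open>auto simp: zeta_halfplane_def eps_def\<close>)
      also have "norm (of_real \<sigma> - 1 :: complex) = \<sigma> - 1" using t by (metis abs_of_pos diff_gt_0_iff_gt norm_of_real of_real_1 of_real_diff)
      also have "norm (of_real \<sigma> :: complex) powr eps \<le> 3 * growth 0"
        by (rule powr_eps_scale) (use t in auto)
      also have "growth 0 = 1" by (simp add: growth_def)
      also have "3 * (1::real) \<le> 6 / (\<sigma> - 1)" using t by (simp add: field_simps)
      finally have "norm (zeta (of_real \<sigma>)) \<le> 1 / (\<sigma> - 1) + 2 * zeta_term_const * (6 / (\<sigma> - 1))"
        using zeta_term_const_nonneg by (simp add: mult_left_mono)
      then show ?thesis by (simp add: A_def add_divide_distrib)
    qed
    have 2: "norm (zeta (Complex \<sigma> (2 * t))) \<le> 2 * K * growth t"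
    proof -
      have "norm (zeta (Complex \<sigma> (2 * t))) \<le> K * growth (2 * t)"
        using K(2)[of "Complex \<sigma> (2 * t)"] t assms by (simp add: eps_def)
      also have "\<dots> \<le> K * (2 * growth t)" using K by (intro mult_left_mono growth_scale) auto
      finally show ?thesis by simp
    qed
    have "1 \<le> norm (zeta (of_real \<sigma>)) ^ 3 * norm (zeta (Complex \<sigma> t)) ^ 4 * norm (zeta (Complex \<sigma> (2 * t)))"
      by (rule zeta_341) fact
    also have "\<dots> \<le> (A / (\<sigma> - 1)) ^ 3 * norm (zeta (Complex \<sigma> t)) ^ 4 * (2 * K * growth t)"
      using A t by (intro mult_mono power_mono 1 2) auto
    finally show "norm (zeta (Complex \<sigma> t)) ^ 4 \<ge> 1 / (A ^ 3 * (2 * K)) * (\<sigma> - 1) ^ 3 / growth t"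
      using A K t growth_pos[of t] by (simp add: field_simps power_divide)
  qed
qed

text \<open>With U = \<open>growth (Im s)\<close>, the 3-4-1 bound at distance \<delta> to the right
  of the line has size \<delta>^(3/4) U^(-1/4), while crossing to the left over a distance 2
  \<delta> changes zeta by at most 2 K U \<delta>. The two are of equal order in U for \<delta> = d
  / U^5, where both are U^(-4); in d they are d^(3/4) against d, so a small d lets the lower bound
  win.\<close>

lemma zeta_lower:
  assumes "\<tau> > 0"
  obtains d \<kappa> where "d > 0" "d \<le> eps / 4" "\<kappa> > 0"
    "\<And>s. \<bar>Im s\<bar> \<ge> \<tau> \<Longrightarrow> Re s \<ge> 1 - d / growth (Im s) ^ 5 \<Longrightarrow> Re s \<le> 3 \<Longrightarrow> norm (zeta s) \<ge> \<kappa> / growth (Im s) ^ 4"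
proof -
  from zeta_deriv_upper[OF assms] obtain K where K: "K > 0"
    "\<And>s. \<bar>Im s\<bar> \<ge> \<tau> \<Longrightarrow> Re s \<ge> 1 - eps / 4 \<Longrightarrow> Re s \<le> 3 \<Longrightarrow> norm (deriv zeta s) \<le> K * growth (Im s)" by blast
  from zeta_power4_lower[OF assms] obtain c where c: "c > 0"
    "\<And>\<sigma> t. \<bar>t\<bar> \<ge> \<tau> \<Longrightarrow> 1 < \<sigma> \<Longrightarrow> \<sigma> \<le> 3 \<Longrightarrow> norm (zeta (Complex \<sigma> t)) ^ 4 \<ge> c * (\<sigma> - 1) ^ 3 / growth t" by blast
  \<comment> \<open>The second entry makes (4 K d)^4 <= c d^3, so the bound on the right is at least
    4 K d / U^4, twice the loss from crossing. The first keeps the segment where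
    \<open>zeta_deriv_upper\<close> applies.\<close>
  define d where "d = min (eps / 4) (c / (256 * K ^ 4))"
  have d: "d > 0" "d \<le> eps / 4" "d \<le> c / (256 * K ^ 4)" using K c by (auto simp: d_def eps_def)
  have dc: "256 * K ^ 4 * d \<le> c" using d(3) K by (simp add: field_simps)
  show ?thesis
  proof (rule that[of d "2 * K * d"])
    fix s assume s: "\<bar>Im s\<bar> \<ge> \<tau>" "Re s \<ge> 1 - d / growth (Im s) ^ 5" "Re s \<le> 3"
    define U where "U = growth (Im s)"
    have U: "U \<ge> 1" by (simp add: U_def growth_ge_1)
    define \<delta> where "\<delta> = d / U ^ 5"
    have "\<delta> \<le> d / 1" unfolding \<delta>_def using d U by (intro divide_left_mono) (auto simp: one_le_power)
    moreover have "\<delta> > 0" using d U by (simp add: \<delta>_def)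
    ultimately have \<delta>: "\<delta> > 0" "\<delta> \<le> eps / 4" using d by auto
    have far: "norm (zeta (Complex \<sigma> (Im s))) \<ge> 4 * K * d / U ^ 4" if "\<sigma> \<ge> 1 + \<delta>" "\<sigma> \<le> 3" for \<sigma>
    proof (rule power_le_imp_le_base[of _ 3])
      have "(4 * K * d / U ^ 4) ^ Suc 3 = (256 * K ^ 4 * d) * d ^ 3 / U ^ 16"
        by (simp add: power_mult_distrib power_divide flip: power_mult) (simp add: eval_nat_numeral)
      also have "\<dots> \<le> c * d ^ 3 / U ^ 16"
        using dc d U by (intro divide_right_mono mult_right_mono) auto
      also have "\<dots> = c * \<delta> ^ 3 / U"
      proof -
        have "U ^ 16 = (U ^ 5) ^ 3 * U" by (simp add: eval_nat_numeral)
        then show ?thesis by (simp add: \<delta>_def power_divide)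
      qed
      also have "\<dots> \<le> c * (\<sigma> - 1) ^ 3 / U"
        using that c \<delta> U by (intro divide_right_mono mult_left_mono power_mono) auto
      also have "\<dots> \<le> norm (zeta (Complex \<sigma> (Im s))) ^ 4"
        unfolding U_def by (rule c(2)) (use that s \<delta> in auto)
      finally show "(4 * K * d / U ^ 4) ^ Suc 3 \<le> norm (zeta (Complex \<sigma> (Im s))) ^ Suc 3" by simp
    qed auto
    show "2 * K * d / growth (Im s) ^ 4 \<le> norm (zeta s)"
    proof (cases "Re s \<ge> 1 + \<delta>")
      case True
      have "2 * K * d / U ^ 4 \<le> 4 * K * d / U ^ 4" using K d U by (intro divide_right_mono) auto
      also have "\<dots> \<le> norm (zeta (Complex (Re s) (Im s)))" by (rule far) (use True s in auto)
      finally show ?thesis by (simp add: U_def)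
    next
      case False
      define s' where "s' = Complex (1 + \<delta>) (Im s)"
      define S where "S = {z. Im z = Im s \<and> Re z \<ge> 1 - eps / 4 \<and> Re z \<le> 3}"
      have "S = closed_segment (Complex (1 - eps / 4) (Im s)) (Complex 3 (Im s))"
        by (auto simp: S_def closed_segment_same_Im closed_segment_eq_real_ivl eps_def)
      then have "convex S" by (simp only: convex_closed_segment)
      have "norm (zeta s - zeta s') \<le> (K * U) * norm (s - s')"
      proof (rule field_differentiable_bound[of S])
        show "(zeta has_field_derivative deriv zeta z) (at z within S)" if "z \<in> S" for z
        proof -
          have "z \<in> zeta_halfplane - {1}" using that s(1) assms by (auto simp: S_def zeta_halfplane_def eps_def)
          then have "(zeta has_field_derivative deriv zeta z) (at z)"
            by (intro holomorphic_derivI[OF holomorphic_zeta]) auto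
          then show ?thesis by (rule has_field_derivative_at_within)
        qed
        show "norm (deriv zeta z) \<le> K * U" if "z \<in> S" for z
          using K(2)[of z] that s by (auto simp: S_def U_def)
        show "s \<in> S" using s False \<delta> by (auto simp: S_def \<delta>_def U_def)
        show "s' \<in> S" using \<delta> by (auto simp: S_def s'_def eps_def)
      qed fact
      also have "norm (s - s') \<le> 2 * \<delta>"
      proof -
        have "norm (s - s') \<le> \<bar>Re (s - s')\<bar> + \<bar>Im (s - s')\<bar>" by (rule cmod_le)
        also have "\<dots> \<le> 2 * \<delta>" using s False by (auto simp: s'_def \<delta>_def U_def)
        finally show ?thesis .
      qed
      also have "K * U * (2 * \<delta>) = 2 * K * d / U ^ 4"
        using U by (simp add: \<delta>_def field_simps eval_nat_numeral)
      finally have *: "norm (zeta s - zeta s') \<le> 2 * K * d / U ^ 4" using K U by (simp add: mult_left_mono)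
      have "4 * K * d / U ^ 4 \<le> norm (zeta s')" unfolding s'_def
        by (rule far) (use \<delta> in \<open>auto simp: eps_def\<close>)
      also have "\<dots> \<le> norm (zeta s) + norm (zeta s - zeta s')"
        by (metis norm_minus_commute norm_triangle_sub add.commute)
      also note *
      finally have "4 * K * d / U ^ 4 \<le> norm (zeta s) + 2 * K * d / U ^ 4" by simp
      moreover have "4 * K * d / U ^ 4 = 2 * K * d / U ^ 4 + 2 * K * d / U ^ 4" by (simp add: field_simps)
      ultimately show ?thesis by (simp add: U_def)
    qed
  qed (use d K in auto)
qed

text \<open>On the line itself, \<open>zeta_lower\<close> is applied with \<tau> = |Im s|.\<close>

lemma zeta_nonzero_Re_ge_1: "Re s \<ge> 1 \<Longrightarrow> Im s \<noteq> 0 \<Longrightarrow> zeta s \<noteq> 0"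
proof (cases "Re s > 1")
  case False
  assume s: "Re s \<ge> 1" "Im s \<noteq> 0"
  then have "\<bar>Im s\<bar> > 0" by simp
  from zeta_lower[OF this] obtain d \<kappa> where d: "d > 0" "\<kappa> > 0"
    "\<And>z. \<bar>Im z\<bar> \<ge> \<bar>Im s\<bar> \<Longrightarrow> Re z \<ge> 1 - d / growth (Im z) ^ 5 \<Longrightarrow> Re z \<le> 3 \<Longrightarrow> norm (zeta z) \<ge> \<kappa> / growth (Im z) ^ 4" by metis
  have "d / growth (Im s) ^ 5 > 0" using d(1) by simp
  with d(3)[of s] False s have "norm (zeta s) \<ge> \<kappa> / growth (Im s) ^ 4" by simp
  moreover have "\<kappa> / growth (Im s) ^ 4 > 0" by (intro divide_pos_pos zero_less_power d(2) growth_pos)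
  ultimately have "norm (zeta s) > 0" by linarith
  then show ?thesis by simp
qed (use zeta_nonzero in auto)

text \<open>Agrees with \<open>1 / zeta s\<close> where that is defined, and removes the singularity at 1.\<close>
definition inv_zeta :: "complex \<Rightarrow> complex" where "inv_zeta s = (s - 1) / zeta_num s"

lemma zeta_num_nonzero: "Re s \<ge> 1 \<Longrightarrow> zeta_num s \<noteq> 0"
proof (cases "s = 1")
  case False
  assume "Re s \<ge> 1"
  with False have "Re s > 1 \<or> Im s \<noteq> 0" by (auto simp: complex_eq_iff)
  with \<open>Re s \<ge> 1\<close> have "zeta s \<noteq> 0" using zeta_nonzero zeta_nonzero_Re_ge_1 by blast
  then show ?thesis by (auto simp: zeta_def)
qed auto

text \<open>An open set containing the closed half-plane Re s >= 1, the point 1 included; it gives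
  the derivatives of \<open>inv_zeta\<close> continuity up to the line.\<close>

definition inv_zeta_dom :: "complex set" where "inv_zeta_dom = {s \<in> zeta_halfplane. zeta_num s \<noteq> 0}"

lemma open_inv_zeta_dom: "open inv_zeta_dom"
proof -
  have "open (zeta_halfplane \<inter> zeta_num -` (- {0}))"
    by (rule continuous_open_preimage[OF holomorphic_on_imp_continuous_on[OF holomorphic_zeta_num]]) auto
  moreover have "inv_zeta_dom = zeta_halfplane \<inter> zeta_num -` (- {0})" by (auto simp: inv_zeta_dom_def)
  ultimately show ?thesis by simp
qed

lemma holomorphic_inv_zeta: "inv_zeta holomorphic_on inv_zeta_dom"
  unfolding inv_zeta_def
  by (intro holomorphic_intros holomorphic_on_subset[OF holomorphic_zeta_num]) (auto simp: inv_zeta_dom_def)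

lemma in_inv_zeta_dom: "Re s \<ge> 1 \<Longrightarrow> s \<in> inv_zeta_dom"
  using zeta_num_nonzero[of s] by (auto simp: inv_zeta_dom_def zeta_halfplane_def eps_def)

text \<open>Cauchy's estimate on discs inside the zero-free region: the values are O(U^4) and the
  radius is of order U^(-5), so the fourth derivative is O(U^24), and 24 eps = 1 / 2.\<close>

lemma inv_zeta_deriv_bound_large:
  obtains C where "C > 0" "\<And>s. \<bar>Im s\<bar> \<ge> 2 \<Longrightarrow> 1 \<le> Re s \<Longrightarrow> Re s \<le> 5 / 2 \<Longrightarrow> norm ((deriv ^^ 4) inv_zeta s) \<le> C * (1 + \<bar>Im s\<bar>) powr (1 / 2)"
proof -
  from zeta_lower[of 1] obtain d \<kappa> where d: "d > 0" "d \<le> eps / 4" and \<kappa>: "\<kappa> > 0" and low: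
    "\<And>z. \<bar>Im z\<bar> \<ge> 1 \<Longrightarrow> Re z \<ge> 1 - d / growth (Im z) ^ 5 \<Longrightarrow> Re z \<le> 3 \<Longrightarrow> norm (zeta z) \<ge> \<kappa> / growth (Im z) ^ 4" by auto
  \<comment> \<open>24 is 4!, 16 is 2^4 from the lower bound for zeta at \<open>2 * U\<close>, 32 is
    2^5 from the radius, and + 1 makes the bound on the values strict.\<close>
  define C where "C = 24 * (16 / \<kappa> + 1) * 32 ^ 4 / d ^ 4"
  show ?thesis
  proof (rule that[of C])
    show "C > 0" using d \<kappa> by (auto simp: C_def intro!: divide_pos_pos mult_pos_pos add_pos_pos)
    fix s assume s: "\<bar>Im s\<bar> \<ge> 2" "1 \<le> Re s" "Re s \<le> 5 / 2"
    define U where "U = growth (Im s)"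
    have U: "U \<ge> 1" by (simp add: U_def growth_ge_1)
    \<comment> \<open>The zero-free region narrows with height; 2 U bounds \<open>growth\<close> on
      the whole disc, so the disc stays inside the region.\<close>
    define r where "r = d / (2 * U) ^ 5"
    have "r \<le> d / 1" unfolding r_def using d U one_le_power[of "2 * U" 5] by (intro divide_left_mono) auto
    then have r: "r > 0" "r \<le> d" "r \<le> eps / 4" using d U by (auto simp: r_def)
    have w: "w \<in> inv_zeta_dom \<and> norm (inv_zeta w) \<le> 16 * U ^ 4 / \<kappa>" if "w \<in> cball s r" for w
    proof -
      have 1: "\<bar>Re w - Re s\<bar> \<le> r" "\<bar>Im w - Im s\<bar> \<le> r"
        using that abs_Re_le_cmod[of "w - s"] abs_Im_le_cmod[of "w - s"] by (auto simp: dist_norm norm_minus_commute)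
      have im: "\<bar>Im w\<bar> \<ge> 1" using 1 r s by (auto simp: eps_def)
      have "\<bar>Im w\<bar> \<le> \<bar>Im s\<bar> + r" "r \<le> 1" using 1 r by (auto simp: eps_def)
      then have g: "growth (Im w) \<le> 2 * U" unfolding U_def using abs_ge_zero[of "Im s"] by (intro growth_scale, simp add: field_simps)
      have "d / (2 * U) ^ 5 \<le> d / growth (Im w) ^ 5"
        using d g U growth_ge_1[of "Im w"] by (intro divide_left_mono power_mono) auto
      then have re: "Re w \<ge> 1 - d / growth (Im w) ^ 5" using 1 s by (auto simp: r_def)
      have low': "norm (zeta w) \<ge> \<kappa> / growth (Im w) ^ 4"
        by (rule low) (use im re 1 r s in \<open>auto simp: eps_def\<close>)
      moreover have "\<kappa> / (2 * U) ^ 4 \<le> \<kappa> / growth (Im w) ^ 4"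
        using \<kappa> g U growth_ge_1[of "Im w"] by (intro divide_left_mono power_mono) auto
      ultimately have low2: "norm (zeta w) \<ge> \<kappa> / (2 * U) ^ 4" by linarith
      moreover have "\<kappa> / (2 * U) ^ 4 > 0" using \<kappa> U by simp
      ultimately have z: "norm (zeta w) > 0" by linarith
      have "norm (inv_zeta w) = 1 / norm (zeta w)" by (simp add: inv_zeta_def zeta_def norm_divide)
      also have "\<dots> \<le> 1 / (\<kappa> / (2 * U) ^ 4)"
        using low2 z \<kappa> U by (intro divide_left_mono) (auto intro!: mult_pos_pos)
      also have "\<dots> = 16 * U ^ 4 / \<kappa>" by (simp add: power_mult_distrib)
      finally have "norm (inv_zeta w) \<le> 16 * U ^ 4 / \<kappa>" .
      moreover have "w \<in> inv_zeta_dom" using z 1 r s by (auto simp: inv_zeta_dom_def zeta_halfplane_def zeta_def eps_def)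
      ultimately show ?thesis by blast
    qed
    have U4: "U ^ 4 \<ge> 1" using U by (rule one_le_power)
    have "norm ((deriv ^^ 4) inv_zeta s) \<le> fact 4 * ((16 / \<kappa> + 1) * U ^ 4) / r ^ 4"
    proof (rule Cauchy_higher_deriv_bound)
      show "inv_zeta holomorphic_on ball s r"
        by (rule holomorphic_on_subset[OF holomorphic_inv_zeta]) (use w ball_subset_cball in blast)
      show "continuous_on (cball s r) inv_zeta"
        by (rule holomorphic_on_imp_continuous_on, rule holomorphic_on_subset[OF holomorphic_inv_zeta]) (use w in blast)
      show "inv_zeta w' \<in> ball 0 ((16 / \<kappa> + 1) * U ^ 4)" if "w' \<in> ball s r" for w'
      proof -
        have "norm (inv_zeta w') \<le> 16 * U ^ 4 / \<kappa>" using w[of w'] that by auto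
        also have "\<dots> < (16 / \<kappa> + 1) * U ^ 4" using U4 U by (simp add: algebra_simps)
        finally show ?thesis by simp
      qed
    qed (use r in auto)
    also have "\<dots> = C * U ^ 24"
    proof -
      have "r ^ 4 = d ^ 4 / (32 ^ 4 * U ^ 20)"
        by (simp add: r_def power_divide power_mult_distrib flip: power_mult)
      moreover have "U ^ 24 = U ^ 4 * U ^ 20" by (simp flip: power_add)
      ultimately show ?thesis using d U by (simp add: C_def fact_numeral mult_ac)
    qed
    also have "U ^ 24 = (1 + \<bar>Im s\<bar>) powr (1 / 2)"
    proof -
      have "U ^ 24 = U powr real 24" using U by (intro powr_realpow[symmetric]) auto
      then show ?thesis by (simp add: U_def growth_def eps_def powr_powr)
    qed
    finally show "norm ((deriv ^^ 4) inv_zeta s) \<le> C * (1 + \<bar>Im s\<bar>) powr (1 / 2)" .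
  qed
qed

text \<open>For |Im s| <= 2 a compact rectangle suffices, since \<open>inv_zeta\<close> is
  holomorphic near it, at s = 1 as well.\<close>

lemma inv_zeta_deriv_bound:
  obtains C where "C > 0" "\<And>s. 1 \<le> Re s \<Longrightarrow> Re s \<le> 5 / 2 \<Longrightarrow> norm ((deriv ^^ 4) inv_zeta s) \<le> C * (1 + \<bar>Im s\<bar>) powr (1 / 2)"
proof -
  from inv_zeta_deriv_bound_large obtain C1 where C1: "C1 > 0" "\<And>s. \<bar>Im s\<bar> \<ge> 2 \<Longrightarrow> 1 \<le> Re s \<Longrightarrow> Re s \<le> 5 / 2 \<Longrightarrow> norm ((deriv ^^ 4) inv_zeta s) \<le> C1 * (1 + \<bar>Im s\<bar>) powr (1 / 2)" by blast
  define B where "B = cbox (Complex 1 (-2)) (Complex (5/2) 2)"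
  have "continuous_on B ((deriv ^^ 4) inv_zeta)"
    by (rule holomorphic_on_imp_continuous_on, rule holomorphic_on_subset[OF holomorphic_higher_deriv[OF holomorphic_inv_zeta open_inv_zeta_dom]])
       (auto simp: B_def in_cbox_complex_iff intro: in_inv_zeta_dom)
  then have "compact ((deriv ^^ 4) inv_zeta ` B)" by (rule compact_continuous_image) (simp add: B_def)
  then have "bounded ((deriv ^^ 4) inv_zeta ` B)" by (rule compact_imp_bounded)
  then obtain C2 where C2: "C2 > 0" "\<And>s. s \<in> B \<Longrightarrow> norm ((deriv ^^ 4) inv_zeta s) \<le> C2"
    by (auto simp: bounded_pos)
  show ?thesis
  proof (rule that[of "C1 + C2"])
    fix s assume s: "1 \<le> Re s" "Re s \<le> 5 / 2"
    have p: "(1 + \<bar>Im s\<bar>) powr (1 / 2) \<ge> 1" by (rule ge_one_powr_ge_zero) auto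
    show "norm ((deriv ^^ 4) inv_zeta s) \<le> (C1 + C2) * (1 + \<bar>Im s\<bar>) powr (1 / 2)"
    proof (cases "\<bar>Im s\<bar> \<ge> 2")
      case True
      from C1(2)[OF this s] have "norm ((deriv ^^ 4) inv_zeta s) \<le> C1 * (1 + \<bar>Im s\<bar>) powr (1 / 2)" .
      moreover have "C2 * (1 + \<bar>Im s\<bar>) powr (1 / 2) \<ge> 0" using C2 by simp
      ultimately show ?thesis by (simp add: distrib_right)
    next
      case False
      then have "norm ((deriv ^^ 4) inv_zeta s) \<le> C2" using s by (intro C2(2)) (auto simp: B_def in_cbox_complex_iff)
      also have "\<dots> \<le> (C1 + C2) * 1" using C1 by simp
      also have "\<dots> \<le> (C1 + C2) * (1 + \<bar>Im s\<bar>) powr (1 / 2)" using p C1 C2 by (intro mult_left_mono) auto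
      finally show ?thesis .
    qed
  qed (use C1 C2 in auto)
qed

section \<open>Perron's formula\<close>

text \<open>The exponent is that of the kernel, -2, plus the growth 1 / 2 of the fourth derivative.
  The half-line is integrated explicitly and then reflected.\<close>

lemma integrable_powr_three_halves: "integrable lborel (\<lambda>t::real. (1 + \<bar>t\<bar>) powr (- 3 / 2))"
proof -
  define f where "f = (\<lambda>t::real. (1 + \<bar>t\<bar>) powr (- 3 / 2))"
  have [measurable]: "f \<in> borel_measurable borel" unfolding f_def by measurable
  have lim: "((\<lambda>x::real. - 2 * (1 + x) powr (- 1 / 2)) \<longlongrightarrow> 0) at_top" by real_asymp
  have "(\<integral>\<^sup>+x. ennreal (f x) * indicator {0..} x \<partial>lborel) = ennreal (0 - (- 2 * (1 + 0) powr (- 1 / 2)))"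
  proof (rule nn_integral_FTC_atLeast)
    show "((\<lambda>x. - 2 * (1 + x) powr (- 1 / 2)) has_real_derivative f x) (at x)" if "0 \<le> x" for x :: real
      unfolding f_def using that by (auto intro!: derivative_eq_intros simp: field_simps)
  qed (use lim in \<open>auto simp: f_def\<close>)
  then have g: "integrable lborel (\<lambda>x. indicator {0..} x * f x)"
    by (intro integrableI_nonneg) (auto simp: f_def indicator_mult_ennreal mult.commute split: split_indicator)
  have "integrable lborel (\<lambda>x. indicator {0..} (0 + (-1) * x) * f (0 + (-1) * x))"
    by (rule lborel_integrable_real_affine[OF g]) simp
  from Bochner_Integration.integrable_add[OF g this]
  have "integrable lborel f"
    by (rule Bochner_Integration.integrable_bound) (auto simp: f_def split: split_indicator)
  then show ?thesis by (simp add: f_def)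
qed

lemma one_plus_abs_Im_le_norm:
  assumes "Re s \<ge> 1"
  shows "2 * norm s \<ge> 1 + \<bar>Im s\<bar>"
  using assms abs_Re_le_cmod[of s] abs_Im_le_cmod[of s] by linarith

lemma norm_perron_kernel_le:
  assumes "Re s \<ge> 1"
  shows "norm (1 / (s * (s + 1))) \<le> 4 * (1 + \<bar>Im s\<bar>) powr (- 2)"
proof -
  define y where "y = 1 + \<bar>Im s\<bar>"
  have y: "y > 0" "2 * norm s \<ge> y" "2 * norm (s + 1) \<ge> y"
    using one_plus_abs_Im_le_norm[of s] one_plus_abs_Im_le_norm[of "s + 1"] assms by (auto simp: y_def)
  have "y * y \<le> (2 * norm s) * (2 * norm (s + 1))"
    by (rule mult_mono) (use y in auto)
  then have "y * y \<le> 4 * (norm s * norm (s + 1))" by simp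
  moreover have "norm s > 0" "norm (s + 1) > 0" using y by linarith+
  ultimately have "1 / (norm s * norm (s + 1)) \<le> 4 / (y * y)"
    using y by (simp add: field_simps)
  also have "4 / (y * y) = 4 * y powr (- 2)"
    using y powr_realpow[of y 2] by (simp add: powr_minus power2_eq_square divide_inverse)
  finally show ?thesis by (simp add: norm_divide norm_mult y_def)
qed

text \<open>For u = ln (X / n) this is (X / n)^s / (s (s + 1)). The factor s + 1 buys absolute
  convergence and turns the sharp cutoff at X into the weight 1 - n / X.\<close>

definition perron_fun :: "real \<Rightarrow> complex \<Rightarrow> complex" where
  "perron_fun u s = exp (of_real u * s) / (s * (s + 1))"

lemma norm_perron_fun_le:
  assumes "Re s \<ge> 1"
  shows "norm (perron_fun u s) \<le> exp (u * Re s) * (4 * (1 + \<bar>Im s\<bar>) powr (- 2))"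
proof -
  have "norm (perron_fun u s) = exp (u * Re s) * norm (1 / (s * (s + 1)))"
    by (simp add: perron_fun_def norm_divide norm_mult)
  also have "\<dots> \<le> exp (u * Re s) * (4 * (1 + \<bar>Im s\<bar>) powr (- 2))"
    by (intro mult_left_mono norm_perron_kernel_le assms) auto
  finally show ?thesis .
qed

lemma perron_fun_line_measurable [measurable]:
  assumes "c \<ge> 1"
  shows "(\<lambda>t. perron_fun u (Complex c t)) \<in> borel_measurable borel"
proof (rule borel_measurable_continuous_onI)
  have "Complex c t \<noteq> 0" "Complex c t + 1 \<noteq> 0" for t using assms by (auto simp: complex_eq_iff)
  then show "continuous_on UNIV (\<lambda>t. perron_fun u (Complex c t))"
    unfolding perron_fun_def by (intro continuous_intros) auto
qed

lemma integrable_perron_fun: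
  assumes "c \<ge> 1"
  shows "integrable lborel (\<lambda>t. perron_fun u (Complex c t))"
proof (rule Bochner_Integration.integrable_bound)
  show "integrable lborel (\<lambda>t::real. exp (u * c) * (4 * (1 + \<bar>t\<bar>) powr (- 3 / 2)))"
    by (intro integrable_mult_right integrable_powr_three_halves)
  have "norm (perron_fun u (Complex c t)) \<le> exp (u * c) * (4 * (1 + \<bar>t\<bar>) powr (- 3 / 2))" for t
  proof -
    have "norm (perron_fun u (Complex c t)) \<le> exp (u * c) * (4 * (1 + \<bar>t\<bar>) powr (- 2))"
      using norm_perron_fun_le[of "Complex c t" u] assms by simp
    also have "\<dots> \<le> exp (u * c) * (4 * (1 + \<bar>t\<bar>) powr (- 3 / 2))"
      by (intro mult_left_mono powr_mono) auto
    finally show ?thesis .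
  qed
  then show "AE t in lborel. norm (perron_fun u (Complex c t)) \<le> norm (exp (u * c) * (4 * (1 + \<bar>t\<bar>) powr (- 3 / 2)))"
    by (intro always_eventually allI) auto
qed (use assms in measurable)

lemma contour_integral_rectpath_sides:
  assumes f: "continuous_on (path_image (rectpath a b)) f" and ab: "Re a \<le> Re b" "Im a \<le> Im b"
    and I: "(f has_contour_integral I) (rectpath a b)"
  shows "I = contour_integral (linepath a (Complex (Re b) (Im a))) f
           + contour_integral (linepath (Complex (Re b) (Im a)) b) f
           + contour_integral (linepath b (Complex (Re a) (Im b))) f
           + contour_integral (linepath (Complex (Re a) (Im b)) a) f"
proof -
  have sub: "closed_segment x y \<subseteq> path_image (rectpath a b)"
    if "(x, y) \<in> {(a, Complex (Re b) (Im a)), (Complex (Re b) (Im a), b), (b, Complex (Re a) (Im b)), (Complex (Re a) (Im b), a)}" for x y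
    using that by (auto simp: rectpath_def Let_def path_image_join)
  have ci: "(f has_contour_integral contour_integral (linepath x y) f) (linepath x y)"
    if "(x, y) \<in> {(a, Complex (Re b) (Im a)), (Complex (Re b) (Im a), b), (b, Complex (Re a) (Im b)), (Complex (Re a) (Im b), a)}" for x y
    by (intro has_contour_integral_integral contour_integrable_continuous_linepath continuous_on_subset[OF f] sub that)
  have "(f has_contour_integral (contour_integral (linepath a (Complex (Re b) (Im a))) f
           + (contour_integral (linepath (Complex (Re b) (Im a)) b) f
           + (contour_integral (linepath b (Complex (Re a) (Im b))) f
           + contour_integral (linepath (Complex (Re a) (Im b)) a) f)))) (rectpath a b)"
    unfolding rectpath_def Let_def
    by (intro has_contour_integral_join ci valid_path_join) auto
  from has_contour_integral_unique[OF I this] show ?thesis by (simp add: add.assoc)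
qed

lemma contour_integral_bound_linepath_cont:
  assumes "continuous_on (closed_segment a b) f" "0 \<le> B" "\<And>x. x \<in> closed_segment a b \<Longrightarrow> norm (f x) \<le> B"
  shows "norm (contour_integral (linepath a b) f) \<le> B * norm (b - a)"
  using has_contour_integral_bound_linepath[OF has_contour_integral_integral[OF contour_integrable_continuous_linepath[OF assms(1)]] assms(2,3)] .

text \<open>T drops to T - 1 because of the factor s + 1: on the left side of the contour |Re s| =
  T, but |s + 1| may be only T - 1.\<close>

lemma norm_perron_fun_far_le:
  assumes "T > 1" "\<bar>Im s\<bar> \<ge> T \<or> \<bar>Re s\<bar> \<ge> T"  "exp (u * Re s) \<le> M"
  shows "norm (perron_fun u s) \<le> M / (T - 1)\<^sup>2"
proof -
  have "norm s \<ge> T - 1" "norm (s + 1) \<ge> T - 1"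
    using assms abs_Re_le_cmod[of s] abs_Im_le_cmod[of s] abs_Re_le_cmod[of "s + 1"] abs_Im_le_cmod[of "s + 1"] by auto
  then have "(T - 1)\<^sup>2 \<le> norm s * norm (s + 1)"
    unfolding power2_eq_square using assms by (intro mult_mono) auto
  moreover have "(T - 1)\<^sup>2 > 0" using assms by simp
  ultimately have "exp (u * Re s) / (norm s * norm (s + 1)) \<le> M / (T - 1)\<^sup>2"
    using assms(3) by (intro frac_le) (auto intro: order_trans[OF exp_ge_zero])
  then show ?thesis by (simp add: perron_fun_def norm_divide norm_mult)
qed

lemma continuous_on_perron_fun:
  assumes "0 \<notin> S" "-1 \<notin> S"
  shows "continuous_on S (perron_fun u)"
proof -
  have "s \<noteq> 0" "s + 1 \<noteq> 0" if "s \<in> S" for s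
    using that assms by (auto simp: add_eq_0_iff) (metis add_eq_0_iff2 minus_unique)
  then show ?thesis unfolding perron_fun_def by (intro continuous_intros) auto
qed

text \<open>Partial fractions 1 / (s (s + 1)) = 1 / s - 1 / (s + 1) reduce the residues to Cauchy's
  formula at 0 and -1, both inside because T > 1.\<close>

lemma perron_rect_nonneg:
  assumes c: "c \<ge> 1" and u: "u \<ge> 0" and T: "T > 1"
  shows "((perron_fun u) has_contour_integral (2 * pi * \<i> * of_real (1 - exp (- u)))) (rectpath (Complex (-T) (-T)) (Complex c T))"
proof -
  let ?\<gamma> = "rectpath (Complex (-T) (-T)) (Complex c T)"
  have im: "path_image ?\<gamma> \<subseteq> UNIV - {z}" if "z \<in> {0, -1}" for z
    using that c T by (subst path_image_rectpath) (auto simp: complex_eq_iff)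
  have w: "winding_number ?\<gamma> z = 1" if "z \<in> {0, -1}" for z
    by (rule winding_number_rectpath) (use that c T in \<open>auto simp: in_box_complex_iff\<close>)
  have *: "((\<lambda>s. exp (of_real u * s) / (s - z)) has_contour_integral (2 * pi * \<i> * winding_number ?\<gamma> z * exp (of_real u * z))) ?\<gamma>"
    if "z \<in> {0, -1}" for z
    by (rule Cauchy_integral_formula_convex_simple[of UNIV]) (use im[OF that] in \<open>auto intro!: holomorphic_intros\<close>)
  have "((\<lambda>s. exp (of_real u * s) / (s - 0) - exp (of_real u * s) / (s - (-1))) has_contour_integral
     (2 * pi * \<i> * winding_number ?\<gamma> 0 * exp (of_real u * 0) - 2 * pi * \<i> * winding_number ?\<gamma> (-1) * exp (of_real u * (-1)))) ?\<gamma>"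
    by (intro has_contour_integral_diff *) auto
  moreover have "exp (of_real u * s) / (s - 0) - exp (of_real u * s) / (s - (-1)) = perron_fun u s" if "s \<in> path_image ?\<gamma>" for s
  proof -
    have "s \<noteq> 0" "s \<noteq> -1" using that im by auto
    then have "s \<noteq> 0" "s + 1 \<noteq> 0" by (auto simp: add_eq_0_iff2)
    then show ?thesis by (simp add: perron_fun_def field_simps)
  qed
  ultimately have "((perron_fun u) has_contour_integral
     (2 * pi * \<i> * winding_number ?\<gamma> 0 * exp (of_real u * 0) - 2 * pi * \<i> * winding_number ?\<gamma> (-1) * exp (of_real u * (-1)))) ?\<gamma>"
    by (rule has_contour_integral_eq)
  then show ?thesis using w by (simp add: algebra_simps exp_of_real flip: of_real_minus)
qed

lemma vertical_integral:
  assumes c: "c \<ge> 1" and T: "T > 0"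
  shows "contour_integral (linepath (Complex c (-T)) (Complex c T)) (perron_fun u)
     = \<i> * (LINT t:{-T..T}|lborel. perron_fun u (Complex c t))"
proof -
  have "set_integrable lborel {-T..T} (\<lambda>t. perron_fun u (Complex c t))"
    unfolding set_integrable_def using integrable_mult_indicator[OF _ integrable_perron_fun[OF c, of u], of "{-T..T}"] by simp
  then show ?thesis using T
    by (subst contour_integral_linepath_same_Re) (auto simp: set_borel_integral_eq_integral(2) Complex_eq mult_ac)
qed

text \<open>The line is closed to the left for u >= 0 and to the right for u < 0, so that exp (u Re
  s) is at most exp (u c) on the three other sides. Their lengths add up to 4T + 2c or 4T, hence the
  common bound 6T + 2c. The right-hand rectangle encloses no pole.\<close>

lemma perron_truncated:
  assumes c: "c \<ge> 1" and T: "T > 1"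
  shows "norm ((LINT t:{-T..T}|lborel. perron_fun u (Complex c t)) - of_real (2 * pi * (if u \<ge> 0 then 1 - exp (- u) else 0)))
     \<le> exp (u * c) / (T - 1)\<^sup>2 * (6 * T + 2 * c)"
proof -
  define M where "M = exp (u * c) / (T - 1)\<^sup>2"
  have M0: "M \<ge> 0" by (simp add: M_def)
  let ?J = "LINT t:{-T..T}|lborel. perron_fun u (Complex c t)"
  have bd: "norm (contour_integral (linepath a b) (perron_fun u)) \<le> M * norm (b - a)"
    if seg: "\<And>s. s \<in> closed_segment a b \<Longrightarrow> (\<bar>Im s\<bar> \<ge> T \<or> \<bar>Re s\<bar> \<ge> T) \<and> u * Re s \<le> u * c" for a b
  proof (rule contour_integral_bound_linepath_cont)
    have "0 \<notin> closed_segment a b" "-1 \<notin> closed_segment a b" using seg T by force+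
    then show "continuous_on (closed_segment a b) (perron_fun u)" by (rule continuous_on_perron_fun)
    show "norm (perron_fun u s) \<le> M" if s: "s \<in> closed_segment a b" for s
      unfolding M_def by (rule norm_perron_fun_far_le) (use seg[OF s] T in auto)
  qed (rule M0)
  show ?thesis
  proof (cases "u \<ge> 0")
    case u: True
    let ?a = "Complex (-T) (-T)" and ?b = "Complex c T"
    have cont: "continuous_on (path_image (rectpath ?a ?b)) (perron_fun u)"
      by (rule continuous_on_perron_fun) (use c T in \<open>auto simp: path_image_rectpath\<close>)
    have ule: "u * x \<le> u * c" if "x \<le> c" for x using u that by (rule mult_left_mono[rotated])
    have 1: "norm (contour_integral (linepath ?a (Complex c (-T))) (perron_fun u)) \<le> M * norm (Complex c (-T) - ?a)"
      by (rule bd) (use c T ule in \<open>auto simp: closed_segment_same_Im closed_segment_eq_real_ivl\<close>)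
    have 2: "norm (contour_integral (linepath ?b (Complex (-T) T)) (perron_fun u)) \<le> M * norm (Complex (-T) T - ?b)"
      by (rule bd) (use c T ule in \<open>auto simp: closed_segment_same_Im closed_segment_eq_real_ivl\<close>)
    have 3: "norm (contour_integral (linepath (Complex (-T) T) ?a) (perron_fun u)) \<le> M * norm (?a - Complex (-T) T)"
      by (rule bd) (use c T ule[of "- T"] in \<open>auto simp: closed_segment_same_Re closed_segment_eq_real_ivl\<close>)
    have "2 * pi * \<i> * of_real (1 - exp (- u)) = contour_integral (linepath ?a (Complex c (-T))) (perron_fun u)
        + \<i> * ?J + contour_integral (linepath ?b (Complex (-T) T)) (perron_fun u)
        + contour_integral (linepath (Complex (-T) T) ?a) (perron_fun u)"
      using contour_integral_rectpath_sides[OF cont _ _ perron_rect_nonneg[OF c u T]] c T vertical_integral[OF c, of T u] by simp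
    then have "\<i> * (?J - of_real (2 * pi * (1 - exp (- u)))) = - (contour_integral (linepath ?a (Complex c (-T))) (perron_fun u)
        + contour_integral (linepath ?b (Complex (-T) T)) (perron_fun u)
        + contour_integral (linepath (Complex (-T) T) ?a) (perron_fun u))"
      by (simp add: algebra_simps)
    then have "norm (?J - of_real (2 * pi * (1 - exp (- u)))) = norm (contour_integral (linepath ?a (Complex c (-T))) (perron_fun u)
        + contour_integral (linepath ?b (Complex (-T) T)) (perron_fun u)
        + contour_integral (linepath (Complex (-T) T) ?a) (perron_fun u))"
      by (metis norm_minus_cancel norm_mult norm_ii mult_1)
    also have "\<dots> \<le> M * norm (Complex c (-T) - ?a) + M * norm (Complex (-T) T - ?b) + M * norm (?a - Complex (-T) T)"
      by (intro norm_triangle_le add_mono 1 2 3 order_refl)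
    also have "\<dots> = M * (4 * T + 2 * c)"
    proof -
      have "norm (Complex c (-T) - ?a) = T + c" "norm (Complex (-T) T - ?b) = T + c" "norm (?a - Complex (-T) T) = 2 * T"
        using c T by (simp_all add: cmod_def real_sqrt_mult flip: power2_minus[of "- T - c"])
      then show ?thesis by (simp add: algebra_simps)
    qed
    also have "\<dots> \<le> M * (6 * T + 2 * c)" using T M0 by (intro mult_left_mono) auto
    finally show ?thesis using u by (simp add: M_def)
  next
    case False
    then have u: "u \<le> 0" by simp
    let ?a = "Complex c (-T)" and ?b = "Complex (c + T) T"
    have cont: "continuous_on (path_image (rectpath ?a ?b)) (perron_fun u)"
      by (rule continuous_on_perron_fun) (use c T in \<open>auto simp: path_image_rectpath\<close>)
    have ule: "u * x \<le> u * c" if "x \<ge> c" for x using u that by (simp add: mult_left_mono_neg)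
    have 1: "norm (contour_integral (linepath ?a (Complex (c + T) (-T))) (perron_fun u)) \<le> M * norm (Complex (c + T) (-T) - ?a)"
      by (rule bd) (use c T ule in \<open>auto simp: closed_segment_same_Im closed_segment_eq_real_ivl\<close>)
    have 2: "norm (contour_integral (linepath ?b (Complex c T)) (perron_fun u)) \<le> M * norm (Complex c T - ?b)"
      by (rule bd) (use c T ule in \<open>auto simp: closed_segment_same_Im closed_segment_eq_real_ivl\<close>)
    have 3: "norm (contour_integral (linepath (Complex (c + T) (-T)) ?b) (perron_fun u)) \<le> M * norm (?b - Complex (c + T) (-T))"
      by (rule bd) (use c T ule in \<open>auto simp: closed_segment_same_Re closed_segment_eq_real_ivl\<close>)
    have hol: "perron_fun u holomorphic_on {s. Re s > 0}"
    proof -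
      have "s \<noteq> 0" "s + 1 \<noteq> 0" if "Re s > 0" for s using that by (auto simp: complex_eq_iff)
      then show ?thesis unfolding perron_fun_def by (intro holomorphic_intros) auto
    qed
    have "((perron_fun u) has_contour_integral 0) (rectpath ?a ?b)"
      by (rule Cauchy_theorem_convex_simple[OF hol convex_halfspace_Re_gt])
         (use c T in \<open>auto simp: path_image_rectpath\<close>)
    from contour_integral_rectpath_sides[OF cont _ _ this] c T
    have "0 = contour_integral (linepath ?a (Complex (c + T) (-T))) (perron_fun u)
        + contour_integral (linepath (Complex (c + T) (-T)) ?b) (perron_fun u)
        + contour_integral (linepath ?b (Complex c T)) (perron_fun u)
        + contour_integral (linepath (Complex c T) ?a) (perron_fun u)" by simp
    \<comment> \<open>The line is now the left side of the rectangle and is traversed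
      downwards.\<close>
    also have "contour_integral (linepath (Complex c T) ?a) (perron_fun u) = - contour_integral (linepath ?a (Complex c T)) (perron_fun u)"
      using contour_integral_reversepath[of "linepath ?a (Complex c T)" "perron_fun u"] by simp
    also have "contour_integral (linepath ?a (Complex c T)) (perron_fun u) = \<i> * ?J"
      using vertical_integral[OF c, of T u] T by simp
    finally have "\<i> * ?J = contour_integral (linepath ?a (Complex (c + T) (-T))) (perron_fun u)
        + contour_integral (linepath (Complex (c + T) (-T)) ?b) (perron_fun u)
        + contour_integral (linepath ?b (Complex c T)) (perron_fun u)" by simp
    then have "norm ?J = norm (contour_integral (linepath ?a (Complex (c + T) (-T))) (perron_fun u)
        + contour_integral (linepath (Complex (c + T) (-T)) ?b) (perron_fun u)
        + contour_integral (linepath ?b (Complex c T)) (perron_fun u))"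
      by (metis norm_mult norm_ii mult_1)
    also have "\<dots> \<le> M * norm (Complex (c + T) (-T) - ?a) + M * norm (?b - Complex (c + T) (-T)) + M * norm (Complex c T - ?b)"
      by (intro norm_triangle_le add_mono 1 2 3 order_refl)
    also have "\<dots> = M * (4 * T)"
    proof -
      have "norm (Complex (c + T) (-T) - ?a) = T" "norm (?b - Complex (c + T) (-T)) = 2 * T" "norm (Complex c T - ?b) = T"
        using c T by (simp_all add: cmod_def real_sqrt_mult)
      then show ?thesis by (simp add: algebra_simps)
    qed
    also have "\<dots> \<le> M * (6 * T + 2 * c)" using T M0 c by (intro mult_left_mono) auto
    finally show ?thesis using False by (simp add: M_def)
  qed
qed

text \<open>Letting T tend to infinity, the error is O(T / T^2), while dominated convergence gives
  the integral over the full line.\<close>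

lemma perron_integral:
  assumes c: "c \<ge> 1"
  shows "(LINT t|lborel. perron_fun u (Complex c t)) = of_real (2 * pi * (if u \<ge> 0 then 1 - exp (- u) else 0))"
proof -
  let ?L = "of_real (2 * pi * (if u \<ge> 0 then 1 - exp (- u) else 0)) :: complex"
  let ?J = "\<lambda>T. LINT t:{-T..T}|lborel. perron_fun u (Complex c t)"
  have A: "(\<lambda>n. ?J (real n)) \<longlonglongrightarrow> (LINT t|lborel. perron_fun u (Complex c t))"
    unfolding set_lebesgue_integral_def
  proof (rule integral_dominated_convergence)
    show "integrable lborel (\<lambda>t. norm (perron_fun u (Complex c t)))"
      using integrable_perron_fun[OF c] by (rule integrable_norm)
    show "AE t in lborel. (\<lambda>n. indicator {- real n..real n} t *\<^sub>R perron_fun u (Complex c t)) \<longlonglongrightarrow> perron_fun u (Complex c t)"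
    proof (rule always_eventually, rule allI, rule tendsto_eventually)
      fix t :: real
      show "\<forall>\<^sub>F n in sequentially. indicator {- real n..real n} t *\<^sub>R perron_fun u (Complex c t) = perron_fun u (Complex c t)"
        using eventually_ge_at_top[of "nat \<lceil>\<bar>t\<bar>\<rceil>"]
      proof eventually_elim
        case (elim n)
        then have "\<bar>t\<bar> \<le> real n" by linarith
        then show ?case by (auto simp: indicator_def)
      qed
    qed
  qed (use c in \<open>auto simp: indicator_def\<close>)
  have B: "(\<lambda>n. ?J (real n)) \<longlonglongrightarrow> ?L"
  proof (rule Lim_null_comparison[THEN LIM_zero_cancel])
    show "\<forall>\<^sub>F n in sequentially. norm (?J (real n) - ?L) \<le> exp (u * c) / (real n - 1)\<^sup>2 * (6 * real n + 2 * c)"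
      using eventually_gt_at_top[of 1] by eventually_elim (rule perron_truncated[OF c], simp)
    have "(\<lambda>n. (6 * real n + 2 * c) / (real n - 1)\<^sup>2) \<longlonglongrightarrow> 0" by real_asymp
    then have "(\<lambda>n. exp (u * c) * ((6 * real n + 2 * c) / (real n - 1)\<^sup>2)) \<longlonglongrightarrow> exp (u * c) * 0"
      by (rule tendsto_mult_left)
    then show "(\<lambda>n. exp (u * c) / (real n - 1)\<^sup>2 * (6 * real n + 2 * c)) \<longlonglongrightarrow> 0" by simp
  qed
  show ?thesis by (rule LIMSEQ_unique[OF A B])
qed

section \<open>Dirichlet series of the derivatives of 1 / zeta\<close>

lemma summable_ln_powr:
  assumes "d > 0"
  shows "summable (\<lambda>n. ln (real n) ^ k * real n powr (- 1 - d))"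
proof -
  \<comment> \<open>With ln n <= n^a / a the logarithms use up at most half of d; k + 1 in place of
    k keeps a well defined for k = 0.\<close>
  define a where "a = d / (2 * (real k + 1))"
  have a: "a > 0" using assms by (simp add: a_def)
  have ak: "a * real k \<le> d / 2" using assms by (simp add: a_def field_simps)
  show ?thesis
  proof (rule summable_comparison_test')
    show "summable (\<lambda>n. 1 / a ^ k * real n powr (- 1 - d / 2))"
      by (intro summable_mult) (subst summable_real_powr_iff, use assms in simp)
    fix n :: nat assume n: "n \<ge> 1"
    have "ln (real n) ^ k \<le> (real n powr a / a) ^ k"
      using n a by (intro power_mono ln_powr_bound) auto
    also have "\<dots> = 1 / a ^ k * real n powr (a * real k)"
      using n by (simp add: power_divide powr_power mult.commute)
    also have "\<dots> \<le> 1 / a ^ k * real n powr (d / 2)"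
      using n a ak by (intro mult_left_mono powr_mono) auto
    finally have "ln (real n) ^ k * real n powr (- 1 - d) \<le> 1 / a ^ k * real n powr (d / 2) * real n powr (- 1 - d)"
      by (rule mult_right_mono) auto
    also have "\<dots> = 1 / a ^ k * real n powr (- 1 - d / 2)"
    proof -
      have "real n powr (d / 2) * real n powr (- 1 - d) = real n powr (d / 2 + (- 1 - d))" by (simp only: powr_add)
      also have "d / 2 + (- 1 - d) = - 1 - d / 2" by (simp add: field_simps)
      finally show ?thesis by (simp add: mult.assoc)
    qed
    finally show "norm (ln (real n) ^ k * real n powr (- 1 - d)) \<le> 1 / a ^ k * real n powr (- 1 - d / 2)"
      using n by simp
  qed
qed

text \<open>Each differentiation of n^(-s) in s contributes a factor - ln n. The entry at n = 0 is
  0, so series may run over all naturals.\<close>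

definition mu_coeff :: "nat \<Rightarrow> nat \<Rightarrow> complex" where
  "mu_coeff k n = of_int (mu n) * of_real (- ln (real n)) ^ k"

lemma norm_mu_coeff_le: "norm (mu_coeff k n) \<le> ln (real n) ^ k"
proof (cases "n = 0")
  case False
  have "norm (mu_coeff k n) = norm (of_int (mu n) :: complex) * ln (real n) ^ k"
    using False by (simp add: mu_coeff_def norm_mult norm_power)
  also have "\<dots> \<le> 1 * ln (real n) ^ k"
    using False by (intro mult_right_mono norm_mu_le) auto
  finally show ?thesis by simp
qed (auto simp: mu_coeff_def)

lemma norm_mu_coeff_powr_le:
  assumes "Re s \<ge> 1 + d"
  shows "norm (mu_coeff k n * of_nat n powr (- s)) \<le> ln (real n) ^ k * real n powr (- 1 - d)"
proof (cases "n = 0")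
  case False
  have "norm (mu_coeff k n * of_nat n powr (- s)) = norm (mu_coeff k n) * real n powr (- Re s)"
    using False by (simp add: norm_mult norm_of_nat_powr)
  also have "\<dots> \<le> ln (real n) ^ k * real n powr (- 1 - d)"
    using False assms by (intro mult_mono norm_mu_coeff_le powr_mono) auto
  finally show ?thesis .
qed auto

text \<open>Induction on k by termwise differentiation, with domination by
  \<open>summable_ln_powr\<close> near each point.\<close>

lemma inv_zeta_higher_deriv_sums:
  assumes "Re s > 1"
  shows "(\<lambda>n. mu_coeff k n * of_nat n powr (- s)) sums ((deriv ^^ k) inv_zeta s)"
  using assms
proof (induction k arbitrary: s)
  case 0
  have "summable (\<lambda>n. of_int (mu n) * of_nat n powr (- s) :: complex)"
    by (rule summable_norm_cancel, rule summable_powr[OF 0 norm_mu_le])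
  moreover have "(\<Sum>n. of_int (mu n) * of_nat n powr (- s)) = inv_zeta s"
    using zeta_mu_sum[OF 0] zeta_nonzero[OF 0] by (simp add: inv_zeta_def zeta_def field_simps)
  ultimately show ?case by (simp add: mu_coeff_def sums_iff)
next
  case (Suc k)
  define S where "S = {s. Re s > 1}"
  have S: "open S" unfolding S_def by (rule open_halfspace_Re_gt)
  have "\<exists>g g'. \<forall>x \<in> S. ((\<lambda>n. mu_coeff k n * of_nat n powr (- x)) sums g x) \<and>
     ((\<lambda>n. mu_coeff (Suc k) n * of_nat n powr (- x)) sums g' x) \<and> (g has_field_derivative g' x) (at x)"
  proof (rule series_and_derivative_comparison_local[OF S])
    show "((\<lambda>x. mu_coeff k n * of_nat n powr (- x)) has_field_derivative mu_coeff (Suc k) n * of_nat n powr (- x)) (at x)" for n x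
    proof (cases "n = 0")
      case False
      have "((\<lambda>x. of_nat n powr (- x) :: complex) has_field_derivative (Ln (of_nat n) * of_nat n powr (- x) * (- 1))) (at x)"
        by (rule DERIV_chain2[OF has_field_derivative_powr_right]) (use False in \<open>auto intro!: derivative_eq_intros\<close>)
      then have "((\<lambda>x. mu_coeff k n * of_nat n powr (- x)) has_field_derivative (mu_coeff k n * (Ln (of_nat n) * of_nat n powr (- x) * (- 1)))) (at x)"
        by (rule DERIV_cmult)
      moreover have "mu_coeff k n * (Ln (of_nat n) * of_nat n powr (- x) * (- 1)) = mu_coeff (Suc k) n * of_nat n powr (- x)"
        using False by (simp add: mu_coeff_def)
      ultimately show ?thesis by simp
    qed (auto simp: mu_coeff_def)
    fix x assume x: "x \<in> S"
    \<comment> \<open>Half the distance to the line: points of the ball of radius d still have real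
      part at least 1 + d.\<close>
    define d where "d = (Re x - 1) / 2"
    have d: "d > 0" using x by (simp add: d_def S_def)
    have "norm (mu_coeff k n * of_nat n powr (- y)) \<le> ln (real n) ^ k * real n powr (- 1 - d)" if "y \<in> ball x d \<inter> S" for y n
    proof (rule norm_mu_coeff_powr_le)
      have "\<bar>Re x - Re y\<bar> \<le> d" using that abs_Re_le_cmod[of "x - y"] by (auto simp: dist_norm)
      moreover have "Re x = 1 + 2 * d" by (simp add: d_def field_simps)
      ultimately show "1 + d \<le> Re y" by linarith
    qed
    then show "\<exists>d h. 0 < d \<and> summable h \<and> (\<forall>\<^sub>F n in sequentially. \<forall>y\<in>ball x d \<inter> S. norm (mu_coeff k n * of_nat n powr (- y)) \<le> h n)"
      using d summable_ln_powr[OF d, of k]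
      by (intro exI[of _ d] exI[of _ "\<lambda>n. ln (real n) ^ k * real n powr (- 1 - d)"]) auto
  qed
  then obtain g g' where g: "\<And>x. x \<in> S \<Longrightarrow> (\<lambda>n. mu_coeff k n * of_nat n powr (- x)) sums g x"
     "\<And>x. x \<in> S \<Longrightarrow> (\<lambda>n. mu_coeff (Suc k) n * of_nat n powr (- x)) sums g' x"
     "\<And>x. x \<in> S \<Longrightarrow> (g has_field_derivative g' x) (at x)" by blast
  have s: "s \<in> S" using Suc.prems by (simp add: S_def)
  have eq: "g x = (deriv ^^ k) inv_zeta x" if "x \<in> S" for x
    using Suc.IH[of x] g(1)[OF that] that by (auto simp: S_def dest: sums_unique2)
  have "((deriv ^^ k) inv_zeta has_field_derivative g' s) (at s)"
    using has_field_derivative_transform_within_open[OF g(3)[OF s] S s] eq by blast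
  then have "(deriv ^^ Suc k) inv_zeta s = g' s" by (simp add: DERIV_imp_deriv)
  then show ?case using g(2)[OF s] by simp
qed

lemma continuous_on_inv_zeta_deriv_line:
  assumes "c \<ge> 1"
  shows "continuous_on UNIV (\<lambda>t. (deriv ^^ k) inv_zeta (Complex c t))"
proof (rule continuous_on_compose2[of inv_zeta_dom "(deriv ^^ k) inv_zeta"])
  show "continuous_on inv_zeta_dom ((deriv ^^ k) inv_zeta)"
    by (intro holomorphic_on_imp_continuous_on holomorphic_higher_deriv holomorphic_inv_zeta open_inv_zeta_dom)
qed (use assms in \<open>auto intro!: continuous_intros in_inv_zeta_dom\<close>)

text \<open>Exchange of sum and integral: n^(-s) is absorbed into the kernel by replacing ln X with
  ln X - ln n, and everything converges absolutely on Re s = c > 1.\<close>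

lemma perron_sums:
  assumes c: "c > 1" and X: "X > 0"
  shows "(\<lambda>n. mu_coeff k n * (LINT t|lborel. perron_fun (ln X - ln (real n)) (Complex c t))) sums
    (LINT t|lborel. (deriv ^^ k) inv_zeta (Complex c t) * perron_fun (ln X) (Complex c t))"
proof -
  let ?f = "\<lambda>n t. mu_coeff k n * perron_fun (ln X - ln (real n)) (Complex c t)"
  have f_eq: "?f n t = (mu_coeff k n * of_nat n powr (- Complex c t)) * perron_fun (ln X) (Complex c t)" for n t
  proof (cases "n = 0")
    case False
    have "of_nat n powr (- Complex c t) = exp (- of_real (ln (real n)) * Complex c t)"
      using False by (simp add: powr_def mult.commute)
    then show ?thesis by (simp add: perron_fun_def left_diff_distrib exp_diff exp_minus divide_inverse)
  qed (simp add: mu_coeff_def)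
  define I where "I = (LINT t|lborel. norm (perron_fun (ln X) (Complex c t)))"
  have int: "integrable lborel (?f n)" for n
    using c by (intro integrable_mult_right integrable_perron_fun) auto
  have nf: "norm (?f n t) \<le> ln (real n) ^ k * real n powr (- 1 - (c - 1)) * norm (perron_fun (ln X) (Complex c t))" for n t
    unfolding f_eq norm_mult[of "_ * _ powr _"] by (intro mult_right_mono norm_mu_coeff_powr_le) auto
  have summ: "summable (\<lambda>n. ln (real n) ^ k * real n powr (- 1 - (c - 1)))"
    by (rule summable_ln_powr) (use c in simp)
  have 1: "AE t in lborel. summable (\<lambda>n. norm (?f n t))"
  proof (intro always_eventually allI)
    fix t
    show "summable (\<lambda>n. norm (?f n t))"
      by (rule summable_comparison_test'[OF summable_mult2[OF summ, of "norm (perron_fun (ln X) (Complex c t))"]])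
         (use nf in auto)
  qed
  have 2: "summable (\<lambda>n. LINT t|lborel. norm (?f n t))"
  proof (rule summable_comparison_test'[OF summable_mult2[OF summ, of I]])
    fix n :: nat
    have "(LINT t|lborel. norm (?f n t)) \<le> (LINT t|lborel. ln (real n) ^ k * real n powr (- 1 - (c - 1)) * norm (perron_fun (ln X) (Complex c t)))"
      by (intro integral_mono integrable_norm int integrable_mult_right integrable_perron_fun nf) (use c in auto)
    then show "norm (LINT t|lborel. norm (?f n t)) \<le> ln (real n) ^ k * real n powr (- 1 - (c - 1)) * I"
      unfolding I_def by (simp add: integral_nonneg_AE)
  qed
  have "(\<lambda>n. LINT t|lborel. ?f n t) sums (LINT t|lborel. (\<Sum>n. ?f n t))"
    by (rule sums_integral[OF int 1 2])
  moreover have "(LINT t|lborel. ?f n t) = mu_coeff k n * (LINT t|lborel. perron_fun (ln X - ln (real n)) (Complex c t))" for n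
    by simp
  moreover have "(\<Sum>n. ?f n t) = (deriv ^^ k) inv_zeta (Complex c t) * perron_fun (ln X) (Complex c t)" for t
    unfolding f_eq using sums_mult2[OF inv_zeta_higher_deriv_sums[of "Complex c t" k]] c
    by (simp add: sums_iff)
  ultimately show ?thesis by simp
qed

text \<open>The integral \<open>?R\<close> is computed as a finite weighted sum by
  \<open>perron_integral\<close> and bounded by O(N) through absolute values; clearing the factor 1
  / N of the weight gives N^2.\<close>

lemma perron_bound:
  obtains C where "C > 0" "\<And>N. N \<ge> 2 \<Longrightarrow>
    \<bar>\<Sum>n\<in>{1..N}. of_int (mu n) * ln (real n) ^ 4 * (real N - real n)\<bar> \<le> C * real N ^ 2"
proof -
  from inv_zeta_deriv_bound obtain C0 where C0: "C0 > 0"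
    "\<And>s. 1 \<le> Re s \<Longrightarrow> Re s \<le> 5 / 2 \<Longrightarrow> norm ((deriv ^^ 4) inv_zeta s) \<le> C0 * (1 + \<bar>Im s\<bar>) powr (1 / 2)" by blast
  define J where "J = (LINT t|lborel. (1 + \<bar>t\<bar>) powr (- 3 / 2 :: real))"
  have J: "J \<ge> 0" unfolding J_def by (rule integral_nonneg_AE) auto
  \<comment> \<open>The summand 1 only secures positivity, as J is merely known to be
    nonnegative.\<close>
  define C where "C = 4 * C0 * exp 1 * J + 1"
  have "C > 0" using C0 J by (auto simp: C_def intro!: add_nonneg_pos mult_nonneg_nonneg)
  moreover have "\<bar>\<Sum>n\<in>{1..N}. of_int (mu n) * ln (real n) ^ 4 * (real N - real n)\<bar> \<le> C * real N ^ 2" if N: "N \<ge> 2" for N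
  proof -
    define X where "X = real N"
    have X: "X \<ge> 2" using N by (simp add: X_def)
    have lnX: "ln X \<ge> 2 / 3"
      using ln2_ge_two_thirds X ln_mono[of 2 X] by linarith
    \<comment> \<open>Then X^c = e X. As ln X >= 2 / 3, c stays within the strip up to 5 / 2 of
      \<open>inv_zeta_deriv_bound\<close>.\<close>
    define c where "c = 1 + 1 / ln X"
    have "1 / ln X \<le> 3 / 2" using lnX by (simp add: field_simps)
    then have c: "c > 1" "c \<le> 5 / 2" using lnX by (auto simp: c_def)
    have Xc: "exp (ln X * c) = exp 1 * X"
      using X lnX by (simp add: c_def distrib_left exp_add)
    let ?R = "LINT t|lborel. (deriv ^^ 4) inv_zeta (Complex c t) * perron_fun (ln X) (Complex c t)"
    let ?b = "\<lambda>n. mu_coeff 4 n * of_real (2 * pi * (if n \<le> N then 1 - real n / X else 0))"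
    have "(LINT t|lborel. perron_fun (ln X - ln (real n)) (Complex c t)) = of_real (2 * pi * (if n \<le> N then 1 - real n / X else 0))"
      if "n \<noteq> 0" for n
    proof -
      have "ln X - ln (real n) \<ge> 0 \<longleftrightarrow> n \<le> N" using that X by (simp add: X_def)
      moreover have "exp (- (ln X - ln (real n))) = real n / X" using that X by (simp add: exp_diff)
      ultimately show ?thesis using c perron_integral[of c "ln X - ln (real n)"] by simp
    qed
    then have "mu_coeff 4 n * (LINT t|lborel. perron_fun (ln X - ln (real n)) (Complex c t)) = ?b n" for n
      by (cases "n = 0") (auto simp: mu_coeff_def)
    with perron_sums[of c X 4] c X have "?b sums ?R" by simp
    moreover have "?b sums (\<Sum>n\<in>{1..N}. ?b n)"
      by (rule sums_finite) (auto simp: mu_coeff_def not_le Suc_le_eq)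
    ultimately have R: "?R = (\<Sum>n\<in>{1..N}. ?b n)" by (rule sums_unique2)
    also have "\<dots> = of_real (2 * pi / X * (\<Sum>n\<in>{1..N}. of_int (mu n) * ln (real n) ^ 4 * (real N - real n)))"
      unfolding sum_distrib_left of_real_sum
    proof (rule sum.cong[OF refl])
      fix n assume "n \<in> {1..N}"
      then have "1 - real n / X = (real N - real n) / X" using X by (simp add: X_def field_simps)
      then show "?b n = of_real (2 * pi / X * (of_int (mu n) * ln (real n) ^ 4 * (real N - real n)))"
        using \<open>n \<in> {1..N}\<close> by (simp add: mu_coeff_def mult_ac)
    qed
    finally have R': "norm ?R = 2 * pi / X * \<bar>\<Sum>n\<in>{1..N}. of_int (mu n) * ln (real n) ^ 4 * (real N - real n)\<bar>"
      using X by (simp only: norm_of_real) (simp add: abs_mult)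
    have "norm ?R \<le> (LINT t|lborel. 4 * C0 * exp 1 * X * (1 + \<bar>t\<bar>) powr (- 3 / 2))"
    proof -
      have bd: "norm ((deriv ^^ 4) inv_zeta (Complex c t) * perron_fun (ln X) (Complex c t)) \<le> 4 * C0 * exp 1 * X * (1 + \<bar>t\<bar>) powr (- 3 / 2)" for t
      proof -
        have "norm ((deriv ^^ 4) inv_zeta (Complex c t) * perron_fun (ln X) (Complex c t))
            \<le> (C0 * (1 + \<bar>t\<bar>) powr (1 / 2)) * (exp (ln X * c) * (4 * (1 + \<bar>t\<bar>) powr (- 2)))"
          unfolding norm_mult
          using C0(2)[of "Complex c t"] norm_perron_fun_le[of "Complex c t" "ln X"] c C0(1)
          by (intro mult_mono) auto
        also have "\<dots> = 4 * C0 * exp 1 * X * ((1 + \<bar>t\<bar>) powr (1 / 2) * (1 + \<bar>t\<bar>) powr (- 2))"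
          unfolding Xc by (simp add: mult_ac)
        also have "(1 + \<bar>t\<bar>) powr (1 / 2) * (1 + \<bar>t\<bar>) powr (- 2) = (1 + \<bar>t\<bar>) powr (- 3 / 2)"
          by (simp flip: powr_add)
        finally show ?thesis .
      qed
      have 1: "integrable lborel (\<lambda>t::real. 4 * C0 * exp 1 * X * (1 + \<bar>t\<bar>) powr (- 3 / 2))"
        by (intro integrable_mult_right integrable_powr_three_halves)
      have m: "(\<lambda>t. (deriv ^^ 4) inv_zeta (Complex c t)) \<in> borel_measurable borel"
        using c by (intro borel_measurable_continuous_onI continuous_on_inv_zeta_deriv_line) auto
      have 2: "integrable lborel (\<lambda>t. (deriv ^^ 4) inv_zeta (Complex c t) * perron_fun (ln X) (Complex c t))"
      proof (rule Bochner_Integration.integrable_bound[OF 1])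
        show "(\<lambda>t. (deriv ^^ 4) inv_zeta (Complex c t) * perron_fun (ln X) (Complex c t)) \<in> borel_measurable lborel"
          using m perron_fun_line_measurable[of c "ln X"] c by (auto intro!: borel_measurable_times)
        show "AE t in lborel. norm ((deriv ^^ 4) inv_zeta (Complex c t) * perron_fun (ln X) (Complex c t)) \<le> norm (4 * C0 * exp 1 * X * (1 + \<bar>t\<bar>) powr (- 3 / 2))"
          using order_trans[OF bd abs_ge_self] by (intro always_eventually allI) (simp only: real_norm_def)
      qed
      show ?thesis
        by (rule order_trans[OF integral_norm_bound integral_mono[OF integrable_norm[OF 2] 1 bd]])
    qed
    also have "\<dots> = 4 * C0 * exp 1 * X * J" by (simp add: J_def)
    finally have "2 * pi / X * \<bar>\<Sum>n\<in>{1..N}. of_int (mu n) * ln (real n) ^ 4 * (real N - real n)\<bar> \<le> 4 * C0 * exp 1 * J * X"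
      unfolding R' by (simp add: mult_ac)
    then have "2 * pi * \<bar>\<Sum>n\<in>{1..N}. of_int (mu n) * ln (real n) ^ 4 * (real N - real n)\<bar> \<le> 4 * C0 * exp 1 * J * X * X"
      using X by (simp add: field_simps)
    moreover have "1 * \<bar>\<Sum>n\<in>{1..N}. of_int (mu n) * ln (real n) ^ 4 * (real N - real n)\<bar> \<le> 2 * pi * \<bar>\<Sum>n\<in>{1..N}. of_int (mu n) * ln (real n) ^ 4 * (real N - real n)\<bar>"
      using pi_gt3 by (intro mult_right_mono) auto
    moreover have "4 * C0 * exp 1 * J * X * X \<le> C * X ^ 2"
      using X by (simp add: C_def power2_eq_square algebra_simps)
    ultimately show ?thesis unfolding X_def by linarith
  qed
  ultimately show ?thesis by (rule that)
qed

section \<open>The summatory function of the Moebius function\<close>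

text \<open>For the fourth root y of x, ln x = 4 ln y <= 4 (y - 1), hence 1 + ln x <= 4 y, and
  squaring gives the claim.\<close>

lemma one_plus_ln_squared_le_sqrt:
  assumes "x \<ge> 1"
  shows "(1 + ln x)\<^sup>2 \<le> 16 * sqrt x"
proof -
  define y where "y = sqrt (sqrt x)"
  have y: "y > 0" "y ^ 2 = sqrt x" using assms by (auto simp: y_def)
  moreover have "y ^ 4 = (y ^ 2) ^ 2" by simp
  ultimately have y4: "y ^ 4 = x" using assms by (simp del: power2_eq_square)
  have "ln x = 4 * ln y" unfolding y4[symmetric] using y(1) by (simp add: ln_realpow)
  moreover have "ln y \<le> y - 1" using y by (intro ln_le_minus_one)
  ultimately have "1 + ln x \<le> 4 * y" by linarith
  moreover have "ln x \<ge> 0" using assms by simp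
  ultimately have "(1 + ln x)\<^sup>2 \<le> (4 * y)\<^sup>2" by (intro power_mono) auto
  then show ?thesis using y by (simp add: power_mult_distrib)
qed

definition mu_ln4_sum :: "nat \<Rightarrow> real" where
  "mu_ln4_sum N = (\<Sum>n\<in>{1..N}. of_int (mu n) * ln (real n) ^ 4)"

text \<open>Moving the endpoint from N to N + h raises each weight with n <= N by exactly h, which
  isolates the unweighted sum.\<close>

lemma sum_add_diff_weights:
  fixes a :: "nat \<Rightarrow> real"
  shows "(\<Sum>n\<in>{1..N+h}. a n * (real (N + h) - real n)) - (\<Sum>n\<in>{1..N}. a n * (real N - real n))
     = real h * (\<Sum>n\<in>{1..N}. a n) + (\<Sum>n\<in>{N<..N+h}. a n * (real (N + h) - real n))"
proof -
  have "{1..N+h} = {1..N} \<union> {N<..N+h}" by auto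
  then have "(\<Sum>n\<in>{1..N+h}. a n * (real (N + h) - real n)) =
    (\<Sum>n\<in>{1..N}. a n * (real (N + h) - real n)) + (\<Sum>n\<in>{N<..N+h}. a n * (real (N + h) - real n))"
    by (simp only:) (rule sum.union_disjoint, auto)
  moreover have "(\<Sum>n\<in>{1..N}. a n * (real (N + h) - real n)) = (\<Sum>n\<in>{1..N}. a n * (real N - real n)) + real h * (\<Sum>n\<in>{1..N}. a n)"
    by (simp add: sum_distrib_left algebra_simps flip: sum.distrib)
  ultimately show ?thesis by simp
qed

lemma abs_real_mu_le: "\<bar>real_of_int (mu n)\<bar> \<le> 1"
  using abs_mu_le[of n] by linarith

text \<open>After division by h the Perron terms give N^2 / h and the short interval gives L^4 h; h
  of size N / (1 + L)^2 makes both O(N (1 + L)^2).\<close>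

lemma mu_ln4_sum_bound:
  obtains C where "C > 0" "\<And>N. N \<ge> 2 \<Longrightarrow> \<bar>mu_ln4_sum N\<bar> \<le> C * real N * (1 + ln (real N))\<^sup>2"
proof -
  from perron_bound obtain C where C: "C > 0" "\<And>N. N \<ge> 2 \<Longrightarrow>
    \<bar>\<Sum>n\<in>{1..N}. of_int (mu n) * ln (real n) ^ 4 * (real N - real n)\<bar> \<le> C * real N ^ 2" by blast
  show ?thesis
  proof (rule that[of "5 * C + 80"])
    fix N :: nat assume N: "N \<ge> 2"
    define L where "L = ln (real N)"
    have L: "L > 0" using N by (simp add: L_def)
    define h where "h = nat \<lceil>real N / (1 + L)\<^sup>2\<rceil>"
    have pos: "real N / (1 + L)\<^sup>2 > 0" using N L by simp
    have h_ge: "real h \<ge> real N / (1 + L)\<^sup>2" unfolding h_def using pos by linarith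
    then have h0: "real h > 0" using pos by linarith
    have sq1: "(1 + L)\<^sup>2 \<ge> 1" using L by (simp add: one_le_power)
    have "real N / (1 + L)\<^sup>2 \<le> real N / 1" using sq1 by (intro divide_left_mono) auto
    then have h_le: "h \<le> N" unfolding h_def by (simp add: nat_le_iff ceiling_le_iff)
    \<comment> \<open>This gives N / (1 + L)^2 >= 1 / 4, so rounding up to h, which adds at most 1,
      is covered by the factor 5.\<close>
    have "1 + L \<le> 2 * sqrt (real N)"
    proof -
      have "ln (sqrt (real N)) \<le> sqrt (real N) - 1" using N by (intro ln_le_minus_one) auto
      then show ?thesis using N by (simp add: L_def ln_sqrt)
    qed
    then have "(1 + L)\<^sup>2 \<le> (2 * sqrt (real N))\<^sup>2" using L by (intro power_mono) auto
    then have "1 \<le> 4 * (real N / (1 + L)\<^sup>2)" using sq1 L by (simp add: power_mult_distrib le_divide_eq mult.commute)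
    moreover have "real h \<le> real N / (1 + L)\<^sup>2 + 1" unfolding h_def using pos by linarith
    ultimately have h_le2: "real h \<le> 5 * (real N / (1 + L)\<^sup>2)" by linarith
    define E where "E = (\<Sum>n\<in>{N<..N+h}. of_int (mu n) * ln (real n) ^ 4 * (real (N + h) - real n))"
    \<comment> \<open>On the short interval n <= 2N <= N^2, so ln n <= 2 L.\<close>
    have "\<bar>E\<bar> \<le> (\<Sum>n\<in>{N<..N+h}. (2 * L) ^ 4 * real h)"
      unfolding E_def
    proof (rule order_trans[OF sum_abs sum_mono])
      fix n assume n: "n \<in> {N<..N+h}"
      have "real n \<le> real N * real N"
      proof -
        have "real n \<le> 2 * real N" using n h_le by simp
        also have "\<dots> \<le> real N * real N" using N by (intro mult_right_mono) auto
        finally show ?thesis .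
      qed
      then have "ln (real n) \<le> ln (real N * real N)" using n N by (intro ln_mono) auto
      also have "\<dots> = 2 * L" using N by (simp add: ln_mult L_def)
      finally have "ln (real n) ^ 4 \<le> (2 * L) ^ 4" using n by (intro power_mono) auto
      then have "\<bar>real_of_int (mu n)\<bar> * ln (real n) ^ 4 * \<bar>real (N + h) - real n\<bar> \<le> 1 * (2 * L) ^ 4 * real h"
        using n by (intro mult_mono abs_real_mu_le) auto
      then show "\<bar>of_int (mu n) * ln (real n) ^ 4 * (real (N + h) - real n)\<bar> \<le> (2 * L) ^ 4 * real h"
        by (simp add: abs_mult)
    qed
    also have "\<dots> = real h * (16 * L ^ 4 * real h)" by (simp add: power_mult_distrib)
    finally have E: "\<bar>E\<bar> \<le> real h * (16 * L ^ 4 * real h)" .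
    have "real h * mu_ln4_sum N = (\<Sum>n\<in>{1..N+h}. of_int (mu n) * ln (real n) ^ 4 * (real (N + h) - real n))
       - (\<Sum>n\<in>{1..N}. of_int (mu n) * ln (real n) ^ 4 * (real N - real n)) - E"
      unfolding sum_add_diff_weights mu_ln4_sum_def E_def by simp
    then have "\<bar>real h * mu_ln4_sum N\<bar> \<le> C * real (N + h) ^ 2 + C * real N ^ 2 + real h * (16 * L ^ 4 * real h)"
      using C(2)[of "N + h"] C(2)[of N] N E by linarith
    also have "C * real (N + h) ^ 2 \<le> C * (2 * real N) ^ 2"
      using C h_le by (intro mult_left_mono power_mono) auto
    also have "C * (2 * real N) ^ 2 + C * real N ^ 2 = 5 * C * (real N * real N)"
      by (simp add: power2_eq_square)
    \<comment> \<open>One factor N is traded for h (1 + L)^2 so that h can be cancelled.\<close>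
    also have "5 * C * (real N * real N) \<le> 5 * C * (real N * (real h * (1 + L)\<^sup>2))"
    proof -
      have "real N \<le> real h * (1 + L)\<^sup>2" using h_ge sq1 L by (simp add: divide_le_eq)
      then show ?thesis using C(1) by (intro mult_left_mono) auto
    qed
    also have "5 * C * (real N * (real h * (1 + L)\<^sup>2)) + real h * (16 * L ^ 4 * real h)
         = real h * (5 * C * real N * (1 + L)\<^sup>2 + 16 * L ^ 4 * real h)" by (simp add: algebra_simps)
    finally have "\<bar>mu_ln4_sum N\<bar> \<le> 5 * C * real N * (1 + L)\<^sup>2 + 16 * L ^ 4 * real h"
      using h0 by (simp add: abs_mult)
    also have "16 * L ^ 4 * real h \<le> 16 * (1 + L) ^ 4 * (5 * (real N / (1 + L)\<^sup>2))"
      using L h_le2 by (intro mult_mono power_mono) auto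
    also have "\<dots> = 80 * real N * (1 + L)\<^sup>2"
    proof -
      have "16 * (Q * Q) * (5 * (real N / Q)) = 80 * real N * Q" if "Q \<ge> 1" for Q :: real
        using that by simp
      from this[OF sq1] show ?thesis by (simp flip: power_add)
    qed
    finally show "\<bar>mu_ln4_sum N\<bar> \<le> (5 * C + 80) * real N * (1 + ln (real N))\<^sup>2"
      by (simp add: L_def algebra_simps)
  qed (use C in simp)
qed

text \<open>Summation by parts: with decreasing nonnegative weights the differences telescope, and
  each boundary term is at most B times a weight.\<close>

lemma abel_inequality:
  fixes w S :: "nat \<Rightarrow> real"
  assumes mN: "m \<le> N" and w: "\<And>n. m \<le> n \<Longrightarrow> n < N \<Longrightarrow> w (Suc n) \<le> w n" "\<And>n. m \<le> n \<Longrightarrow> w n \<ge> 0"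
    and S: "\<And>n. m \<le> n \<Longrightarrow> n \<le> N \<Longrightarrow> \<bar>S n\<bar> \<le> B"
  shows "\<bar>\<Sum>n\<in>{m<..N}. w n * (S n - S (n - 1))\<bar> \<le> 2 * B * w m"
proof -
  \<comment> \<open>Splitting off w k * S k makes the induction work: B w m bounds the initial
    boundary term and B (w m - w k) the telescoping sum.\<close>
  have "\<bar>(\<Sum>n\<in>{m<..k}. w n * (S n - S (n - 1))) - w k * S k\<bar> \<le> B * (2 * w m - w k)" if "m \<le> k" "k \<le> N" for k
    using that
  proof (induction k rule: dec_induct)
    case base
    have "w m * \<bar>S m\<bar> \<le> w m * B" using w(2)[of m] S[of m] mN by (intro mult_left_mono) auto
    then show ?case using w(2)[of m] by (simp add: abs_mult mult.commute)
  next
    case (step k)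
    have "{m<..Suc k} = insert (Suc k) {m<..k}" using step by auto
    then have "(\<Sum>n\<in>{m<..Suc k}. w n * (S n - S (n - 1))) - w (Suc k) * S (Suc k)
        = ((\<Sum>n\<in>{m<..k}. w n * (S n - S (n - 1))) - w k * S k) + (w k - w (Suc k)) * S k"
      by (simp add: algebra_simps)
    also have "\<bar>\<dots>\<bar> \<le> B * (2 * w m - w k) + (w k - w (Suc k)) * B"
    proof (rule order_trans[OF abs_triangle_ineq add_mono])
      show "\<bar>(w k - w (Suc k)) * S k\<bar> \<le> (w k - w (Suc k)) * B"
        using w(1)[of k] S[of k] step by (auto simp: abs_mult intro!: mult_left_mono)
    qed (use step in simp)
    also have "\<dots> = B * (2 * w m - w (Suc k))" by (simp add: algebra_simps)
    finally show ?case .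
  qed
  from this[of N] mN have "\<bar>(\<Sum>n\<in>{m<..N}. w n * (S n - S (n - 1))) - w N * S N\<bar> \<le> B * (2 * w m - w N)" by simp
  moreover have "\<bar>w N * S N\<bar> \<le> B * w N"
    using w(2)[of N] S[of N] mN mult_left_mono[of "\<bar>S N\<bar>" B "w N"] by (simp add: abs_mult mult.commute)
  moreover have "B * (2 * w m - w N) + B * w N = 2 * B * w m" by (simp add: algebra_simps)
  ultimately show ?thesis by linarith
qed

definition mertens :: "nat \<Rightarrow> real" where
  "mertens N = (\<Sum>n\<in>{1..N}. of_int (mu n))"

lemma abs_mertens_le: "\<bar>mertens N\<bar> \<le> real N"
proof -
  have "\<bar>mertens N\<bar> \<le> (\<Sum>n\<in>{1..N}. 1)"
    unfolding mertens_def by (rule order_trans[OF sum_abs sum_mono]) (rule abs_real_mu_le)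
  then show ?thesis by simp
qed

text \<open>Partial summation with weights 1 / ln^4 n starts at sqrt N, where ln n is already
  comparable to ln N; the part below is estimated trivially. With 1 + ln N the bound makes sense at
  N = 1 too.\<close>

lemma mertens_bound:
  obtains C where "C > 0" "\<And>N. N \<ge> 1 \<Longrightarrow> \<bar>mertens N\<bar> \<le> C * real N / (1 + ln (real N))\<^sup>2"
proof -
  from mu_ln4_sum_bound obtain K where K: "K > 0" "\<And>N. N \<ge> 2 \<Longrightarrow> \<bar>mu_ln4_sum N\<bar> \<le> K * real N * (1 + ln (real N))\<^sup>2" by blast
  show ?thesis
  \<comment> \<open>8192 = 2 * 8^4, from \<open>abel_inequality\<close> and the weight at m; 25
    covers both N < 4 and the initial segment up to m.\<close>
  proof (rule that[of "25 + 8192 * K"])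
    fix N :: nat assume N: "N \<ge> 1"
    define L where "L = ln (real N)"
    have L0: "L \<ge> 0" using N by (simp add: L_def)
    then have sq: "(1 + L)\<^sup>2 > 0" by simp
    show "\<bar>mertens N\<bar> \<le> (25 + 8192 * K) * real N / (1 + ln (real N))\<^sup>2"
    proof (cases "N \<ge> 4")
      case False
      have "ln (real N) \<le> real N - 1" using N by (intro ln_le_minus_one) auto
      then have "(1 + L)\<^sup>2 \<le> 5\<^sup>2" using False L0 unfolding L_def by (intro power_mono) auto
      also have "\<dots> \<le> 25 + 8192 * K" using K by simp
      finally have "real N * (1 + L)\<^sup>2 \<le> real N * (25 + 8192 * K)" by (rule mult_left_mono) auto
      then have "real N \<le> (25 + 8192 * K) * real N / (1 + L)\<^sup>2" using sq by (simp add: field_simps)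
      with abs_mertens_le[of N] show ?thesis by (simp add: L_def)
    next
      case True
      define m where "m = nat \<lfloor>sqrt (real N)\<rfloor>"
      have s2: "sqrt (real N) \<ge> 2" using True by (intro real_le_rsqrt) auto
      have m: "real m \<le> sqrt (real N)" "sqrt (real N) < real m + 1" unfolding m_def using s2 by linarith+
      have m2: "m \<ge> 2" unfolding m_def using s2 by (simp add: le_nat_iff le_floor_iff)
      have "sqrt (real N) \<le> real N"
        using True by (intro real_le_lsqrt) (auto simp: power2_eq_square)
      then have mN: "m \<le> N" using m by linarith
      \<comment> \<open>Compensates the rounding in m: sqrt N < m + 1 <= m^2 yields N <= m^4, hence
        ln m >= L / 4.\<close>
      have "real m + 1 \<le> real m * real m"
      proof -
        have "2 * real m \<le> real m * real m" using m2 by (intro mult_right_mono) auto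
        then show ?thesis using m2 by linarith
      qed
      then have "sqrt (real N) \<le> real m ^ 2" using m by (simp add: power2_eq_square)
      then have "real N \<le> (real m ^ 2) ^ 2" using power_mono[of "sqrt (real N)" "real m ^ 2" 2] by simp
      then have "L \<le> ln ((real m ^ 2) ^ 2)" unfolding L_def using N m2 by (intro ln_mono) auto
      also have "\<dots> = 4 * ln (real m)" using m2 by (simp add: ln_realpow)
      finally have lnm: "ln (real m) \<ge> L / 4" by simp
      have "L \<ge> ln 4" unfolding L_def using True by (intro ln_mono) auto
      moreover have "ln (4::real) = 2 * ln 2" using ln_realpow[of 2 2] by simp
      \<comment> \<open>Lets L / 4 be replaced by (1 + L) / 8.\<close>
      ultimately have L1: "L \<ge> 1" using ln2_ge_two_thirds by simp
      have wm: "1 / ln (real m) ^ 4 \<le> 4096 / (1 + L) ^ 4"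
      proof -
        have "(1 + L) / 8 \<le> ln (real m)" using lnm L1 by simp
        then have "((1 + L) / 8) ^ 4 \<le> ln (real m) ^ 4" using L1 by (intro power_mono) auto
        moreover have "((1 + L) / 8) ^ 4 > 0" using L1 by (intro zero_less_power) simp
        ultimately have "1 / ln (real m) ^ 4 \<le> 1 / ((1 + L) / 8) ^ 4" by (intro frac_le) auto
        then show ?thesis by (simp add: power_divide)
      qed
      have "\<bar>\<Sum>n\<in>{m<..N}. 1 / ln (real n) ^ 4 * (mu_ln4_sum n - mu_ln4_sum (n - 1))\<bar> \<le> 2 * (K * real N * (1 + L)\<^sup>2) * (1 / ln (real m) ^ 4)"
      proof (rule abel_inequality[OF mN])
        show "1 / ln (real (Suc n)) ^ 4 \<le> 1 / ln (real n) ^ 4" if "m \<le> n" for n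
          using that m2 by (intro divide_left_mono power_mono mult_pos_pos zero_less_power) auto
        show "\<bar>mu_ln4_sum n\<bar> \<le> K * real N * (1 + L)\<^sup>2" if "m \<le> n" "n \<le> N" for n
        proof -
          have "\<bar>mu_ln4_sum n\<bar> \<le> K * real n * (1 + ln (real n))\<^sup>2" using K(2)[of n] that m2 by simp
          also have "\<dots> \<le> K * real N * (1 + L)\<^sup>2"
            unfolding L_def using that m2 K by (intro mult_mono power_mono) auto
          finally show ?thesis .
        qed
      qed auto
      also have "(\<Sum>n\<in>{m<..N}. 1 / ln (real n) ^ 4 * (mu_ln4_sum n - mu_ln4_sum (n - 1))) = (\<Sum>n\<in>{m<..N}. of_int (mu n))"
      proof (rule sum.cong[OF refl])
        fix n assume n: "n \<in> {m<..N}"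
        then obtain k where k: "n = Suc k" by (cases n) auto
        have "mu_ln4_sum n - mu_ln4_sum (n - 1) = of_int (mu n) * ln (real n) ^ 4" unfolding mu_ln4_sum_def k by simp
        moreover have "ln (real n) \<noteq> 0" using n m2 by simp
        ultimately show "1 / ln (real n) ^ 4 * (mu_ln4_sum n - mu_ln4_sum (n - 1)) = of_int (mu n)" by simp
      qed
      also have "2 * (K * real N * (1 + L)\<^sup>2) * (1 / ln (real m) ^ 4) \<le> 2 * (K * real N * (1 + L)\<^sup>2) * (4096 / (1 + L) ^ 4)"
        using K by (intro mult_left_mono wm) auto
      also have "\<dots> = 8192 * K * real N / (1 + L)\<^sup>2"
      proof -
        have "2 * (K * real N * Q) * (4096 / (Q * Q)) = 8192 * K * real N / Q" if "Q > 0" for Q :: real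
          using that by simp
        from this[OF sq] show ?thesis by (simp flip: power_add)
      qed
      finally have 1: "\<bar>\<Sum>n\<in>{m<..N}. of_int (mu n)\<bar> \<le> 8192 * K * real N / (1 + L)\<^sup>2" by simp
      have "{1..N} = {1..m} \<union> {m<..N}" using mN by auto
      then have "mertens N = mertens m + (\<Sum>n\<in>{m<..N}. of_int (mu n))"
        unfolding mertens_def by (simp only:) (rule sum.union_disjoint, auto)
      then have "\<bar>mertens N\<bar> \<le> real m + 8192 * K * real N / (1 + L)\<^sup>2"
        using 1 abs_mertens_le[of m] by linarith
      also have "real m \<le> 25 * real N / (1 + L)\<^sup>2"
      proof -
        have "(1 + L)\<^sup>2 \<le> 25 * sqrt (real N)" using one_plus_ln_squared_le_sqrt[of "real N"] N s2 unfolding L_def by simp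
        then have "sqrt (real N) * (1 + L)\<^sup>2 \<le> sqrt (real N) * (25 * sqrt (real N))" by (intro mult_left_mono) auto
        also have "\<dots> = 25 * real N" by simp
        finally have "sqrt (real N) \<le> 25 * real N / (1 + L)\<^sup>2" using sq by (simp add: field_simps)
        then show ?thesis using m by simp
      qed
      finally show ?thesis by (simp add: L_def add_divide_distrib algebra_simps)
    qed
  qed (use K in simp)
qed

section \<open>Chebyshev's bound for prime powers\<close>

lemma prime_prod_dvd:
  fixes n :: nat
  assumes "finite P" "\<And>p. p \<in> P \<Longrightarrow> prime p" "\<And>p. p \<in> P \<Longrightarrow> p dvd n"
  shows "\<Prod>P dvd n"
  using assms
proof (induction P rule: finite_induct)
  case (insert p P)
  have "coprime p (\<Prod>P)"
    using insert by (intro prod_coprime_right) (auto intro!: primes_coprime)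
  then show ?case using insert by (auto intro: divides_mult)
qed auto

text \<open>These primes divide (2m+1)! but neither m! nor (m+1)!, hence the binomial coefficient.
  That coefficient occurs twice in its row, whose sum is 2 * 4^m.\<close>

lemma primes_between_prod_le: "\<Prod>{p. prime p \<and> m + 1 < p \<and> p \<le> 2 * m + 1} \<le> (4::nat) ^ m"
proof -
  let ?P = "{p::nat. prime p \<and> m + 1 < p \<and> p \<le> 2 * m + 1}"
  let ?c = "(2 * m + 1) choose m"
  have fin: "finite ?P" by (rule finite_subset[of _ "{..2 * m + 1}"]) auto
  have "\<Prod>?P dvd ?c"
  proof (rule prime_prod_dvd[OF fin])
    fix p assume p: "p \<in> ?P"
    then have "p dvd fact (2 * m + 1)" by (subst prime_dvd_fact_iff) auto
    also have "fact (2 * m + 1) = fact m * fact (m + 1) * ?c"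
    proof -
      have "2 * m + 1 - m = m + 1" by simp
      then show ?thesis using binomial_fact_lemma[of m "2 * m + 1"] by (simp only:)
    qed
    finally show "p dvd ?c"
      using p by (simp only: prime_dvd_mult_iff mem_Collect_eq prime_dvd_fact_iff) auto
  qed auto
  then have "\<Prod>?P \<le> ?c" by (rule dvd_imp_le) (simp add: zero_less_binomial)
  also have "2 * ?c \<le> 2 ^ (2 * m + 1)"
  proof -
    have "(2 * m + 1) choose (m + 1) = ?c"
      using binomial_symmetric[of m "2 * m + 1"] by simp
    then have "2 * ?c = (\<Sum>k\<in>{m, m + 1}. (2 * m + 1) choose k)" by simp
    also have "\<dots> \<le> (\<Sum>k\<le>2 * m + 1. (2 * m + 1) choose k)" by (rule sum_mono2) auto
    also have "\<dots> = 2 ^ (2 * m + 1)" by (rule choose_row_sum)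
    finally show ?thesis .
  qed
  then have "?c \<le> 4 ^ m" by (simp add: power_mult)
  finally show ?thesis .
qed

text \<open>Erdos's induction: an even n > 2 adds no prime, and for n = 2m + 1 the primes split at m
  + 1.\<close>

lemma primorial_le: "\<Prod>(primes_le n) \<le> 4 ^ n"
proof (induction n rule: less_induct)
  case (less n)
  consider "n \<le> 2" | "n > 2" "even n" | m where "n = 2 * m + 1" "m \<ge> 1"
  proof (cases "n \<le> 2")
    case False
    show ?thesis
    proof (cases "even n")
      case odd: False
      then obtain m where "n = 2 * m + 1" by (rule oddE)
      with False that(3)[of m] show ?thesis by simp
    qed (use False that in simp)
  qed (use that in simp)
  then show ?case
  proof cases
    case 1
    have "primes_le n = (if n = 2 then {2} else {})"
      using 1 by (auto simp: primes_le_def dest: prime_ge_2_nat)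
    then show ?thesis by simp
  next
    case 2
    then have "\<not> prime n" using prime_odd_nat[of n] by blast
    then have "p \<le> n \<longleftrightarrow> p \<le> n - 1" if "prime p" for p
      using that by (cases "p = n") auto
    then have "primes_le n = primes_le (n - 1)" unfolding primes_le_def by blast
    moreover have "\<Prod>(primes_le (n - 1)) \<le> 4 ^ (n - 1)" using 2 by (intro less) auto
    moreover have "(4::nat) ^ (n - 1) \<le> 4 ^ n" by (intro power_increasing) auto
    ultimately show ?thesis by (metis order_trans)
  next
    case 3
    let ?P = "{p. prime p \<and> m + 1 < p \<and> p \<le> 2 * m + 1}"
    have "primes_le n = primes_le (m + 1) \<union> ?P" using 3 by (auto simp: primes_le_def)
    moreover have "finite ?P" by (rule finite_subset[of _ "{..2 * m + 1}"]) auto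
    moreover have "primes_le (m + 1) \<inter> ?P = {}" by (auto simp: primes_le_def)
    ultimately have "\<Prod>(primes_le n) = \<Prod>(primes_le (m + 1)) * \<Prod>?P"
      by (simp only: prod.union_disjoint finite_primes_le)
    also have "\<dots> \<le> 4 ^ (m + 1) * 4 ^ m"
      using 3 by (intro mult_mono less primes_between_prod_le) auto
    also have "\<dots> = 4 ^ n" using 3 by (simp add: power_add mult_2)
    finally show ?thesis .
  qed
qed

text \<open>Prime powers are kept as pairs (p, k), the form in which the iterated sum over p and k
  produces them.\<close>

definition prime_power_pairs :: "nat \<Rightarrow> (nat \<times> nat) set" where
  "prime_power_pairs n = {(p, k). prime p \<and> 1 \<le> k \<and> p ^ k \<le> n}"

lemma prime_power_pairs_subset: "prime_power_pairs n \<subseteq> primes_le n \<times> {1..n}"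
proof clarify
  fix p k assume "(p, k) \<in> prime_power_pairs n"
  then have pk: "prime p" "1 \<le> k" "p ^ k \<le> n" by (auto simp: prime_power_pairs_def)
  have p: "p \<ge> 2" using pk by (simp add: prime_ge_2_nat)
  have "p \<le> p ^ k" using pk p power_increasing[of 1 k p] by simp
  moreover have "k < 2 ^ k" by simp
  moreover have "(2::nat) ^ k \<le> p ^ k" using p by (intro power_mono) auto
  ultimately have "k \<le> n" "p \<le> n" using pk(3) by linarith+
  then show "p \<in> primes_le n \<and> k \<in> {1..n}" using pk unfolding primes_le_def by simp
qed

lemma finite_prime_power_pairs [simp]: "finite (prime_power_pairs n)"
  by (rule finite_subset[OF prime_power_pairs_subset]) simp

text \<open>Each prime above sqrt n contributes at least (ln n) / 2 to the sum of ln p over p <= n,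
  which \<open>primorial_le\<close> bounds by n ln 4 <= 2 n.\<close>

lemma card_large_primes_le:
  assumes "n \<ge> 2"
  shows "real (card {p \<in> primes_le n. n < p ^ 2}) \<le> 4 * real n / ln (real n)"
proof -
  let ?A = "{p \<in> primes_le n. n < p ^ 2}"
  have "real (card ?A) * (ln (real n) / 2) = (\<Sum>p\<in>?A. ln (real n) / 2)" by simp
  also have "\<dots> \<le> (\<Sum>p\<in>?A. ln (real p))"
  proof (rule sum_mono)
    fix p assume "p \<in> ?A"
    then have p: "n < p ^ 2" "p > 0" by (auto simp: primes_le_def prime_gt_0_nat)
    have "ln (real n) \<le> ln (real p ^ 2)" using p assms
      by (intro ln_mono) (auto simp flip: of_nat_power)
    then show "ln (real n) / 2 \<le> ln (real p)" using p by (simp add: ln_realpow)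
  qed
  also have "\<dots> \<le> (\<Sum>p\<in>primes_le n. ln (real p))"
    by (rule sum_mono2) (auto simp: primes_le_def dest: prime_ge_1_nat)
  also have "\<dots> = ln (real (\<Prod>(primes_le n)))"
    by (simp, subst ln_prod) (auto simp: primes_le_def prime_gt_0_nat)
  also have "\<dots> \<le> ln (4 ^ n)"
  proof (rule ln_mono)
    have "\<Prod>(primes_le n) > 0" by (rule prod_pos) (auto simp: primes_le_def prime_gt_0_nat)
    then show "real (\<Prod>(primes_le n)) > 0" by linarith
    have "real (\<Prod>(primes_le n)) \<le> real (4 ^ n)" using primorial_le[of n] by (simp only: of_nat_le_iff)
    then show "real (\<Prod>(primes_le n)) \<le> 4 ^ n" by simp
  qed
  also have "\<dots> = real n * ln 4" by (simp add: ln_realpow)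
  also have "ln (4::real) = 2 * ln 2" using ln_realpow[of 2 2] by simp
  also have "real n * (2 * ln 2) \<le> real n * 2"
    using ln_le_minus_one[of "2::real"] by (intro mult_left_mono) auto
  finally show ?thesis using assms by (simp add: field_simps)
qed

text \<open>Either p > sqrt n, which forces k = 1, or p <= sqrt n and k <= 2 ln n, because 2^k <= n
  and ln 2 >= 1 / 2.\<close>

lemma card_prime_power_pairs_le:
  assumes "n \<ge> 2"
  shows "real (card (prime_power_pairs n)) \<le> 4 * real n / ln (real n) + 2 * sqrt (real n) * ln (real n)"
proof -
  define s where "s = nat \<lfloor>sqrt (real n)\<rfloor>"
  define l where "l = nat \<lfloor>2 * ln (real n)\<rfloor>"
  have lnn: "ln (real n) \<ge> 0" using assms by simp
  have sub: "prime_power_pairs n \<subseteq> {p \<in> primes_le n. n < p ^ 2} \<times> {1} \<union> {1..s} \<times> {1..l}"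
  proof (rule subsetI, rule UnCI)
    fix x assume x: "x \<in> prime_power_pairs n" and nx: "x \<notin> {1..s} \<times> {1..l}"
    obtain p k where pk_eq: "x = (p, k)" by (cases x)
    have pk': "(p, k) \<in> prime_power_pairs n" and no: "(p, k) \<notin> {1..s} \<times> {1..l}"
      using x nx pk_eq by auto
    then have pk: "prime p" "1 \<le> k" "p ^ k \<le> n" by (auto simp: prime_power_pairs_def)
    have p: "p \<ge> 2" using pk by (simp add: prime_ge_2_nat)
    have pn: "p \<in> primes_le n" using prime_power_pairs_subset pk' by auto
    have kl: "k \<le> l"
    proof -
      have "(2::nat) ^ k \<le> p ^ k" using p by (intro power_mono) auto
      also note pk(3)
      finally have "2 ^ k \<le> real n" by (metis of_nat_le_iff of_nat_numeral of_nat_power)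
      then have "ln (2 ^ k) \<le> ln (real n)" by (intro ln_mono) auto
      then have "real k * ln 2 \<le> ln (real n)" by (simp add: ln_realpow)
      moreover have "real k * (1 / 2) \<le> real k * ln 2" using ln2_ge_two_thirds by (intro mult_left_mono) auto
      ultimately have "real k \<le> 2 * ln (real n)" by linarith
      then show ?thesis unfolding l_def by (simp add: le_nat_iff le_floor_iff)
    qed
    have "\<not> p \<le> s" using no kl pk p by auto
    then have "real p > sqrt (real n)" unfolding s_def by (simp add: le_nat_iff le_floor_iff)
    then have "real p ^ 2 > real n" using power_strict_mono[of "sqrt (real n)" "real p" 2] by simp
    then have np: "n < p ^ 2" by (simp flip: of_nat_power)
    have "k = 1"
    proof (rule ccontr)
      assume "k \<noteq> 1"
      then have "p ^ 2 \<le> p ^ k" using pk p by (intro power_increasing) auto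
      then show False using np pk by simp
    qed
    then show "x \<in> {p \<in> primes_le n. n < p ^ 2} \<times> {1}" using np pn pk_eq by blast
  qed
  have "card (prime_power_pairs n) \<le> card ({p \<in> primes_le n. n < p ^ 2} \<times> {1::nat} \<union> {1..s} \<times> {1..l})"
    by (rule card_mono[OF _ sub]) auto
  also have "\<dots> \<le> card ({p \<in> primes_le n. n < p ^ 2} \<times> {1::nat}) + card ({1..s} \<times> {1..l})"
    by (rule card_Un_le)
  also have "\<dots> = card {p \<in> primes_le n. n < p ^ 2} + s * l" by (simp add: card_cartesian_product)
  finally have "real (card (prime_power_pairs n)) \<le> real (card {p \<in> primes_le n. n < p ^ 2}) + real s * real l"
    by (metis of_nat_add of_nat_le_iff of_nat_mult)
  also have "real (card {p \<in> primes_le n. n < p ^ 2}) \<le> 4 * real n / ln (real n)"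
    by (rule card_large_primes_le[OF assms])
  also have "real s * real l \<le> sqrt (real n) * (2 * ln (real n))"
    using lnn by (intro mult_mono) (auto simp: s_def l_def)
  finally show ?thesis by simp
qed

section \<open>Summation over prime powers\<close>

definition mertens_dvd :: "nat \<Rightarrow> nat \<Rightarrow> real" where
  "mertens_dvd p N = (\<Sum>n\<in>{1..N}. if p dvd n then of_int (mu n) else 0)"

text \<open>Write the multiples as n = p m: mu(p m) is - mu(m) unless p divides m, so what remains
  is the full sum up to N / p, negated, with the multiples of p restored.\<close>

lemma mertens_dvd_rec:
  assumes p: "prime p"
  shows "mertens_dvd p N = mertens_dvd p (N div p) - mertens (N div p)"
proof -
  have p0: "p > 0" using p by (simp add: prime_gt_0_nat)
  have im: "{n \<in> {1..N}. p dvd n} = (\<lambda>m. p * m) ` {1..N div p}"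
  proof (intro equalityI subsetI)
    fix n assume n: "n \<in> {n \<in> {1..N}. p dvd n}"
    then obtain m where m: "n = p * m" by auto
    with n p0 have "m \<in> {1..N div p}" by (auto simp: less_eq_div_iff_mult_less_eq mult.commute)
    then show "n \<in> (\<lambda>m. p * m) ` {1..N div p}" using m by auto
  qed (use p0 in \<open>auto simp: less_eq_div_iff_mult_less_eq mult.commute\<close>)
  have "mertens_dvd p N = (\<Sum>n\<in>{n \<in> {1..N}. p dvd n}. of_int (mu n))"
    unfolding mertens_dvd_def by (rule sum.inter_filter[symmetric]) simp
  also have "\<dots> = (\<Sum>m\<in>{1..N div p}. of_int (mu (p * m)))"
    unfolding im using p0 by (subst sum.reindex) (auto simp: inj_on_def)
  also have "\<dots> = (\<Sum>m\<in>{1..N div p}. (if p dvd m then of_int (mu m) else 0) - of_int (mu m))"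
    by (intro sum.cong) (auto simp: mu_prime_mult[OF p])
  also have "\<dots> = mertens_dvd p (N div p) - mertens (N div p)"
    by (simp add: mertens_dvd_def mertens_def sum_subtractf)
  finally show ?thesis .
qed

text \<open>The recursion unrolled. The upper limit N is generous: once p^k exceeds N the terms are
  \<open>mertens 0\<close> = 0.\<close>

lemma abs_mertens_dvd_le:
  assumes p: "prime p"
  shows "\<bar>mertens_dvd p N\<bar> \<le> (\<Sum>k\<in>{1..N}. \<bar>mertens (N div p ^ k)\<bar>)"
proof (induction N rule: less_induct)
  case (less N)
  show ?case
  proof (cases "N = 0")
    case False
    let ?M = "N div p"
    have p2: "p \<ge> 2" using p by (simp add: prime_ge_2_nat)
    have "?M \<le> N div 2" using p2 by (intro div_le_mono2) auto
    then have M: "?M < N" "Suc ?M \<le> N" using False by auto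
    have "\<bar>mertens_dvd p N\<bar> \<le> \<bar>mertens ?M\<bar> + \<bar>mertens_dvd p ?M\<bar>"
      unfolding mertens_dvd_rec[OF p, of N] by linarith
    also have "\<bar>mertens_dvd p ?M\<bar> \<le> (\<Sum>k\<in>{1..?M}. \<bar>mertens (?M div p ^ k)\<bar>)"
      by (rule less[OF M(1)])
    also have "\<dots> = (\<Sum>k\<in>{1..?M}. \<bar>mertens (N div p ^ Suc k)\<bar>)" by (simp add: div_mult2_eq)
    also have "\<dots> = (\<Sum>k\<in>{Suc 1..Suc ?M}. \<bar>mertens (N div p ^ k)\<bar>)"
      by (rule sum.shift_bounds_cl_Suc_ivl[symmetric])
    also have "\<bar>mertens ?M\<bar> + \<dots> = (\<Sum>k\<in>insert 1 {Suc 1..Suc ?M}. \<bar>mertens (N div p ^ k)\<bar>)" by simp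
    also have "\<dots> \<le> (\<Sum>k\<in>{1..N}. \<bar>mertens (N div p ^ k)\<bar>)"
      using M False by (intro sum_mono2) auto
    finally show ?thesis by simp
  qed (simp add: mertens_dvd_def)
qed

definition S_omega :: "nat \<Rightarrow> real" where
  "S_omega N = (\<Sum>n\<in>{1..N}. of_int (mu n) * real (omega n))"

text \<open>\<open>omega n\<close> is written as a sum over the primes dividing n, and the order of
  summation is exchanged.\<close>

lemma S_omega_eq: "S_omega N = (\<Sum>p\<in>primes_le N. mertens_dvd p N)"
proof -
  have "real (omega n) = (\<Sum>p\<in>primes_le N. if p dvd n then 1 else 0)" if "n \<in> {1..N}" for n
  proof -
    have "prime_factors n = {p \<in> primes_le N. p dvd n}"
    proof -
      have "n \<noteq> 0" and "p \<le> N" if "p dvd n" for p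
        using \<open>n \<in> {1..N}\<close> dvd_imp_le[OF that] by auto
      with \<open>n \<in> {1..N}\<close> show ?thesis by (auto simp: primes_le_def prime_factors_dvd)
    qed
    then have "real (omega n) = (\<Sum>p\<in>{p \<in> primes_le N. p dvd n}. 1)" by (simp add: omega_def)
    also have "\<dots> = (\<Sum>p\<in>primes_le N. if p dvd n then 1 else 0)" by (rule sum.inter_filter) simp
    finally show ?thesis .
  qed
  then have "S_omega N = (\<Sum>n\<in>{1..N}. \<Sum>p\<in>primes_le N. if p dvd n then of_int (mu n) else 0)"
    unfolding S_omega_def by (simp add: sum_distrib_left if_distrib cong: if_cong)
  also have "\<dots> = (\<Sum>p\<in>primes_le N. mertens_dvd p N)"
    unfolding mertens_dvd_def by (rule sum.swap)
  finally show ?thesis .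
qed

lemma abs_S_omega_le: "\<bar>S_omega N\<bar> \<le> (\<Sum>(p, k)\<in>prime_power_pairs N. \<bar>mertens (N div p ^ k)\<bar>)"
proof -
  have "\<bar>S_omega N\<bar> \<le> (\<Sum>p\<in>primes_le N. \<Sum>k\<in>{1..N}. \<bar>mertens (N div p ^ k)\<bar>)"
    unfolding S_omega_eq
    by (rule order_trans[OF sum_abs sum_mono], rule abs_mertens_dvd_le) (simp add: primes_le_def)
  also have "\<dots> = (\<Sum>(p, k)\<in>primes_le N \<times> {1..N}. \<bar>mertens (N div p ^ k)\<bar>)"
    by (simp add: sum.cartesian_product)
  also have "\<dots> = (\<Sum>(p, k)\<in>prime_power_pairs N. \<bar>mertens (N div p ^ k)\<bar>)"
  proof (rule sum.mono_neutral_right)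
    show "\<forall>i\<in>primes_le N \<times> {1..N} - prime_power_pairs N. (case i of (p, k) \<Rightarrow> \<bar>mertens (N div p ^ k)\<bar>) = 0"
    proof clarify
      fix p k assume "p \<in> primes_le N" "k \<in> {1..N}" "(p, k) \<notin> prime_power_pairs N"
      then have "N < p ^ k" by (auto simp: prime_power_pairs_def primes_le_def)
      then show "\<bar>mertens (N div p ^ k)\<bar> = 0" by (simp add: mertens_def)
    qed
  qed (use prime_power_pairs_subset in auto)
  finally show ?thesis .
qed

text \<open>The denominator 1 + ln n covers n = 1. Since ln n >= 1 / 2 for n >= 2, the constant is
  12 for large primes plus 32 for the remaining pairs.\<close>

lemma card_prime_power_pairs_le':
  assumes "n \<ge> 1"
  shows "real (card (prime_power_pairs n)) \<le> 44 * real n / (1 + ln (real n))"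
proof (cases "n = 1")
  case True
  have "prime_power_pairs 1 = {}"
  proof -
    have False if "(p, k) \<in> prime_power_pairs 1" for p k
      using subsetD[OF prime_power_pairs_subset that] by (auto simp: primes_le_def dest: prime_ge_2_nat)
    then show ?thesis by auto
  qed
  then show ?thesis using True by simp
next
  case False
  then have n: "n \<ge> 2" using assms by simp
  define L where "L = ln (real n)"
  have L: "L \<ge> 1 / 2" using ln2_ge_two_thirds n ln_mono[of 2 "real n"] unfolding L_def by linarith
  have "4 * real n / L \<le> 12 * real n / (1 + L)"
    using L n by (simp add: divide_le_eq le_divide_eq field_simps)
  moreover have "2 * sqrt (real n) * L \<le> 32 * real n / (1 + L)"
  proof -
    have "L * (1 + L) \<le> (1 + L)\<^sup>2" using L by (simp add: power2_eq_square mult_right_mono)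
    also have "\<dots> \<le> 16 * sqrt (real n)" unfolding L_def using n by (intro one_plus_ln_squared_le_sqrt) auto
    finally have "2 * sqrt (real n) * (L * (1 + L)) \<le> 2 * sqrt (real n) * (16 * sqrt (real n))"
      by (rule mult_left_mono) auto
    also have "\<dots> = 32 * real n" by simp
    finally show ?thesis using L by (simp add: le_divide_eq mult.assoc)
  qed
  ultimately have "4 * real n / L + 2 * sqrt (real n) * L \<le> 44 * real n / (1 + L)"
    by (simp add: add_divide_distrib)
  with card_prime_power_pairs_le[OF n] show ?thesis unfolding L_def by linarith
qed

lemma sum_inverse_squares_le: "(\<Sum>j<Suc J. 1 / (1 + real j)\<^sup>2) \<le> 2 - 1 / (1 + real J)"
proof (induction J)
  case (Suc J)
  have "1 / (2 + real J)\<^sup>2 \<le> 1 / ((1 + real J) * (2 + real J))"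
    unfolding power2_eq_square by (intro divide_left_mono mult_right_mono mult_pos_pos) auto
  also have "\<dots> = 1 / (1 + real J) - 1 / (2 + real J)" by (simp add: field_simps)
  finally show ?case using Suc by simp
qed simp

text \<open>The saving 1 / a^2 of the Moebius sum meets the density 1 / b of prime powers, with a +
  b = J + 2. Partial fractions pull out 1 / (a + b), and 1 / (a b) <= 1 / a^2 + 1 / b^2 leaves three
  convergent sums of inverse squares.\<close>

lemma sum_convolution_le:
  "(\<Sum>j<Suc J. 1 / ((1 + real j)\<^sup>2 * (1 + real (J - j)))) \<le> 6 / (real J + 2)"
proof -
  have "(\<Sum>j<Suc J. 1 / ((1 + real j)\<^sup>2 * (1 + real (J - j))))
     \<le> (\<Sum>j<Suc J. 1 / (real J + 2) * (2 * (1 / (1 + real j)\<^sup>2) + 1 / (1 + real (J - j))\<^sup>2))"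
  proof (rule sum_mono)
    fix j assume j: "j \<in> {..<Suc J}"
    define a b where "a = 1 + real j" and "b = 1 + real (J - j)"
    have ab: "a > 0" "b > 0" "a + b = real J + 2" using j by (auto simp: a_def b_def of_nat_diff)
    have "1 / (a\<^sup>2 * b) = 1 / (a + b) * (1 / a\<^sup>2 + 1 / (a * b))"
      using ab by (simp add: field_simps power2_eq_square)
    also have "1 / (a * b) \<le> 1 / a\<^sup>2 + 1 / b\<^sup>2"
    proof -
      have "2 * (1 / a) * (1 / b) \<le> (1 / a)\<^sup>2 + (1 / b)\<^sup>2" by (rule sum_squares_bound)
      moreover have "1 / a * (1 / b) \<ge> 0" using ab by simp
      ultimately have "1 / a * (1 / b) \<le> (1 / a)\<^sup>2 + (1 / b)\<^sup>2" by linarith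
      then show ?thesis by (simp add: power_divide)
    qed
    then have "1 / (a + b) * (1 / a\<^sup>2 + 1 / (a * b)) \<le> 1 / (a + b) * (2 * (1 / a\<^sup>2) + 1 / b\<^sup>2)"
      using ab by (intro mult_left_mono) auto
    finally show "1 / ((1 + real j)\<^sup>2 * (1 + real (J - j))) \<le> 1 / (real J + 2) * (2 * (1 / (1 + real j)\<^sup>2) + 1 / (1 + real (J - j))\<^sup>2)"
      unfolding a_def[symmetric] b_def[symmetric] ab(3)[symmetric] .
  qed
  also have "\<dots> = 1 / (real J + 2) * (2 * (\<Sum>j<Suc J. 1 / (1 + real j)\<^sup>2) + (\<Sum>j<Suc J. 1 / (1 + real (Suc J - Suc j))\<^sup>2))"
    unfolding sum_distrib_left[symmetric] sum.distrib by simp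
  \<comment> \<open>Reversal of the order of summation; J - j was written as Suc J - Suc j to fit
    the reindexing rule.\<close>
  also have "(\<Sum>j<Suc J. 1 / (1 + real (Suc J - Suc j))\<^sup>2) = (\<Sum>j<Suc J. 1 / (1 + real j)\<^sup>2)"
    by (rule sum.nat_diff_reindex)
  also have "1 / (real J + 2) * (2 * (\<Sum>j<Suc J. 1 / (1 + real j)\<^sup>2) + (\<Sum>j<Suc J. 1 / (1 + real j)\<^sup>2)) \<le> 1 / (real J + 2) * 6"
  proof (rule mult_left_mono)
    have "1 / (1 + real J) \<ge> 0" by simp
    then show "2 * (\<Sum>j<Suc J. 1 / (1 + real j)\<^sup>2) + (\<Sum>j<Suc J. 1 / (1 + real j)\<^sup>2) \<le> 6"
      using sum_inverse_squares_le[of J] by linarith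
  qed auto
  finally show ?thesis by simp
qed

lemma one_plus_ln_power2_le:
  assumes "2 ^ j \<le> y"
  shows "1 + real j \<le> 2 * (1 + ln (real y))"
proof -
  have *: "2 ^ j \<le> real y" using assms by (metis of_nat_le_iff of_nat_numeral of_nat_power)
  then have "ln (2 ^ j) \<le> ln (real y)" by (intro ln_mono) auto
  then have "real j * ln 2 \<le> ln (real y)" by (simp add: ln_realpow)
  moreover have "real j * (1 / 2) \<le> real j * ln 2" using ln2_ge_two_thirds by (intro mult_left_mono) auto
  ultimately have "real j * (1 / 2) \<le> ln (real y)" by (rule order_trans[rotated])
  then show ?thesis by simp
qed

text \<open>The pairs with N div p^k in [2^j, 2^(j+1)) satisfy p^k <= N / 2^j, so there are O(N /
  (2^j (1 + J - j))) of them, each contributing at most \<open>B j\<close>. The powers of 2 cancel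
  and \<open>sum_convolution_le\<close> applies.\<close>

lemma S_omega_bound:
  obtains K where "K > 0" "\<And>N. N \<ge> 2 \<Longrightarrow> \<bar>S_omega N\<bar> \<le> K * real N / ln (real N)"
proof -
  from mertens_bound obtain C where C: "C > 0"
    "\<And>N. N \<ge> 1 \<Longrightarrow> \<bar>mertens N\<bar> \<le> C * real N / (1 + ln (real N))\<^sup>2" by blast
  \<comment> \<open>8 = 2 * 4: the argument y is below 2 * 2^j, and 1 + ln y >= (1 + j) / 2 enters
    squared.\<close>
  define B where "B = (\<lambda>j::nat. 8 * C * 2 ^ j / (1 + real j)\<^sup>2)"
  have B0: "B j \<ge> 0" for j using C by (simp add: B_def)
  have MB: "\<bar>mertens y\<bar> \<le> B j" if "2 ^ j \<le> y" "y < 2 ^ Suc j" for y j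
  proof -
    have y1: "y \<ge> 1" using that(1) by (metis one_le_numeral one_le_power order_trans)
    have "((1 + real j) / 2)\<^sup>2 \<le> (1 + ln (real y))\<^sup>2"
      using one_plus_ln_power2_le[OF that(1)] by (intro power_mono) auto
    moreover have "real y \<le> 2 * 2 ^ j"
      using that(2) by (metis less_imp_le of_nat_le_iff of_nat_numeral of_nat_power power_Suc)
    ultimately have "C * real y / (1 + ln (real y))\<^sup>2 \<le> C * (2 * 2 ^ j) / ((1 + real j) / 2)\<^sup>2"
      using C by (intro frac_le mult_left_mono) auto
    also have "\<dots> = B j" by (simp add: B_def power_divide)
    finally show ?thesis using C(2)[OF y1] by linarith
  qed
  show ?thesis
  proof (rule that[of "4224 * C"])
    fix N :: nat assume N: "N \<ge> 2"
    obtain J where J: "2 ^ J \<le> N" "N < 2 ^ (J + 1)" using ex_power_ivl1[of 2 N] N by auto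
    have "\<bar>S_omega N\<bar> \<le> (\<Sum>(p, k)\<in>prime_power_pairs N. \<bar>mertens (N div p ^ k)\<bar>)"
      by (rule abs_S_omega_le)
    \<comment> \<open>Each pair is counted for every j with p^k <= N div 2^j, not just for its own
      dyadic range. The surplus is nonnegative, and the inner condition becomes one that the prime
      power count handles.\<close>
    also have "\<dots> \<le> (\<Sum>(p, k)\<in>prime_power_pairs N. \<Sum>j<Suc J. if (p, k) \<in> prime_power_pairs (N div 2 ^ j) then B j else 0)"
    proof (rule sum_mono, clarify)
      fix p k assume "(p, k) \<in> prime_power_pairs N"
      then have pk: "prime p" "1 \<le> k" "p ^ k \<le> N" by (auto simp: prime_power_pairs_def)
      have pk0: "p ^ k > 0" using pk by (simp add: prime_gt_0_nat)
      then have "N div p ^ k \<ge> 1" using pk(3) by (simp add: less_eq_div_iff_mult_less_eq)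
      then obtain j where j: "2 ^ j \<le> N div p ^ k" "N div p ^ k < 2 ^ (j + 1)" using ex_power_ivl1[of 2 "N div p ^ k"] by auto
      have "(2::nat) ^ j \<le> N" using j(1) by (meson div_le_dividend order_trans)
      then have "(2::nat) ^ j < 2 ^ (J + 1)" using J by linarith
      then have jJ: "j < Suc J" by (subst (asm) power_strict_increasing_iff) auto
      have "p ^ k \<le> N div 2 ^ j" using j(1) pk0 by (simp add: less_eq_div_iff_mult_less_eq mult.commute)
      then have "(p, k) \<in> prime_power_pairs (N div 2 ^ j)" using pk by (simp add: prime_power_pairs_def)
      then have "\<bar>mertens (N div p ^ k)\<bar> \<le> (if (p, k) \<in> prime_power_pairs (N div 2 ^ j) then B j else 0)"
        using MB[of j "N div p ^ k"] j by simp
      also have "\<dots> \<le> (\<Sum>j<Suc J. if (p, k) \<in> prime_power_pairs (N div 2 ^ j) then B j else 0)"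
        using jJ B0 by (intro member_le_sum) auto
      finally show "\<bar>mertens (N div p ^ k)\<bar> \<le> (\<Sum>j<Suc J. if (p, k) \<in> prime_power_pairs (N div 2 ^ j) then B j else 0)" .
    qed
    also have "\<dots> = (\<Sum>j<Suc J. \<Sum>x\<in>prime_power_pairs N. if x \<in> prime_power_pairs (N div 2 ^ j) then B j else 0)"
      unfolding case_prod_unfold prod.collapse by (rule sum.swap)
    also have "\<dots> = (\<Sum>j<Suc J. real (card (prime_power_pairs (N div 2 ^ j))) * B j)"
    proof (rule sum.cong[OF refl])
      fix j
      have sub: "prime_power_pairs (N div 2 ^ j) \<subseteq> prime_power_pairs N"
        by (auto simp: prime_power_pairs_def intro: order_trans[OF _ div_le_dividend])
      have "(\<Sum>x\<in>prime_power_pairs N. if x \<in> prime_power_pairs (N div 2 ^ j) then B j else 0) = (\<Sum>x\<in>prime_power_pairs (N div 2 ^ j). B j)"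
        using sub by (intro sum.mono_neutral_cong_right) auto
      then show "(\<Sum>x\<in>prime_power_pairs N. if x \<in> prime_power_pairs (N div 2 ^ j) then B j else 0) = real (card (prime_power_pairs (N div 2 ^ j))) * B j"
        by simp
    qed
    \<comment> \<open>704 = 44 * 2 * 8, from the prime power count, from 1 + ln y >= (1 + J - j) /
      2, and from \<open>B\<close>.\<close>
    also have "\<dots> \<le> (\<Sum>j<Suc J. 704 * C * real N * (1 / ((1 + real j)\<^sup>2 * (1 + real (J - j)))))"
    proof (rule sum_mono)
      fix j assume j: "j \<in> {..<Suc J}"
      define y where "y = N div 2 ^ j"
      have "(2::nat) ^ (J - j) * 2 ^ j = 2 ^ J" using j by (simp flip: power_add)
      then have y: "2 ^ (J - j) \<le> y" unfolding y_def using J by (simp add: less_eq_div_iff_mult_less_eq)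
      then have y1: "y \<ge> 1" by (metis one_le_numeral one_le_power order_trans)
      have "real y \<le> real N / 2 ^ j"
        unfolding y_def using of_nat_div_le_of_nat[of N "2 ^ j", where ?'a = real] by simp
      moreover have "(1 + real (J - j)) / 2 \<le> 1 + ln (real y)"
        using one_plus_ln_power2_le[OF y] by (simp add: field_simps)
      ultimately have "44 * real y / (1 + ln (real y)) \<le> 44 * (real N / 2 ^ j) / ((1 + real (J - j)) / 2)"
        by (intro frac_le mult_left_mono) auto
      with card_prime_power_pairs_le'[OF y1]
      have "real (card (prime_power_pairs y)) \<le> 44 * (real N / 2 ^ j) / ((1 + real (J - j)) / 2)" by linarith
      then have "real (card (prime_power_pairs y)) * B j \<le> 44 * (real N / 2 ^ j) / ((1 + real (J - j)) / 2) * B j"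
        by (rule mult_right_mono[OF _ B0])
      also have "\<dots> = 704 * C * real N * (1 / ((1 + real j)\<^sup>2 * (1 + real (J - j))))"
        by (simp add: B_def mult_ac)
      finally show "real (card (prime_power_pairs (N div 2 ^ j))) * B j \<le> 704 * C * real N * (1 / ((1 + real j)\<^sup>2 * (1 + real (J - j))))"
        by (simp add: y_def)
    qed
    also have "\<dots> = 704 * C * real N * (\<Sum>j<Suc J. 1 / ((1 + real j)\<^sup>2 * (1 + real (J - j))))"
      by (rule sum_distrib_left[symmetric])
    also have "\<dots> \<le> 704 * C * real N * (6 / (real J + 2))"
      using C by (intro mult_left_mono sum_convolution_le) auto
    also have "\<dots> \<le> 704 * C * real N * (6 / ln (real N))"
    proof -
      have "real N \<le> 2 ^ (J + 1)" using J(2) by (metis less_imp_le of_nat_le_iff of_nat_numeral of_nat_power)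
      then have "ln (real N) \<le> ln (2 ^ (J + 1))" using N by (intro ln_mono) auto
      also have "\<dots> = (real J + 1) * ln 2" by (subst ln_realpow) auto
      also have "\<dots> \<le> (real J + 1) * 1" using ln_le_minus_one[of "2::real"] by (intro mult_left_mono) auto
      finally have "ln (real N) \<le> real J + 2" by simp
      moreover have "ln (real N) > 0" using N by simp
      ultimately show ?thesis using C by (intro mult_left_mono divide_left_mono mult_pos_pos) auto
    qed
    finally show "\<bar>S_omega N\<bar> \<le> 4224 * C * real N / ln (real N)" by simp
  qed (use C in simp)
qed

theorem theorem1:
  shows "\<exists>C::real. \<forall>x::real. x \<ge> 2 \<longrightarrow> \<bar>M_omega x\<bar> \<le> C * (x / ln x)"
proof -
  from S_omega_bound obtain K where K: "K > 0"
    "\<And>N. N \<ge> 2 \<Longrightarrow> \<bar>S_omega N\<bar> \<le> K * real N / ln (real N)" by blast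
  have "\<bar>M_omega x\<bar> \<le> 2 * K * (x / ln x)" if x: "x \<ge> 2" for x :: real
  proof -
    define N where "N = nat \<lfloor>x\<rfloor>"
    have N: "N \<ge> 2" "real N \<le> x" "x < real N + 1" using x unfolding N_def by linarith+
    have "{n. 1 \<le> n \<and> real n \<le> x} = {1..N}"
      unfolding N_def using x by (auto simp: le_nat_iff le_floor_iff)
    then have "M_omega x = S_omega N" by (simp add: M_omega_def S_omega_def)
    then have "\<bar>M_omega x\<bar> \<le> K * real N / ln (real N)" using K(2)[OF N(1)] by simp
    \<comment> \<open>Rounding down to N costs at most a factor 2 in the logarithm: x <= 2 N <= N^2
      gives ln N >= (ln x) / 2.\<close>
    also have "\<dots> \<le> K * x / (ln x / 2)"
    proof (rule frac_le)
      have "x \<le> real N * real N"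
      proof -
        have "2 * real N \<le> real N * real N" using N by (intro mult_right_mono) auto
        then show ?thesis using N by linarith
      qed
      then have "ln x \<le> ln (real N * real N)" using x by (intro ln_mono) auto
      also have "\<dots> = 2 * ln (real N)" using N by (simp add: ln_mult)
      finally show "ln x / 2 \<le> ln (real N)" by simp
    qed (use K x N in auto)
    finally show ?thesis by (simp add: mult_ac)
  qed
  then show ?thesis by blast
qed

end
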